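(* Let $C\subset\mathbb{P}^2$ be an irreducible singular cubic curve with singular point $P$, and let $X\subset C$ be a reduced set of $3t+\delta$ points of $C$ with $P\in X$, where $0\le\delta\le 2$. Assume further that $t>3$. Then the Hilbert function of the double point scheme $Z=2X$ is as follows. In all cases $\Delta h_Z(i)=i+1$ for $0\le i\le 5$ and $\Delta h_Z(i)=6$ for $5\le i\le t+2$, and: (1) If $\delta=0$, then $\Delta h_Z(t+3)=5$, $\Delta h_Z(i)=3$ for $t+4\le i\le 2t$, $\Delta h_Z(2t+1)=1$, and $\Delta h_Z(i)=0$ for $i\ge 2t+2$. (2) If $\delta=1$, then either $\Delta h_Z(t+3)=6$, $\Delta h_Z(i)=3$ for $t+4\le i\le 2t+1$, and $\Delta h_Z(i)=0$ for $i\ge 2t+2$; or $\Delta h_Z(t+3)=5$, $\Delta h_Z(t+4)=4$, $\Delta h_Z(i)=3$ for $t+5\le i\le 2t+1$, and $\Delta h_Z(i)=0$ for $i\ge 2t+2$. (3) If $\delta=2$, then $\Delta h_Z(t+3)=6$, $\Delta h_Z(t+4)=4$, $\Delta h_Z(i)=3$ for $t+5\le i\le 2t+1$, $\Delta h_Z(2t+2)=2$, and $\Delta h_Z(i)=0$ for $i\ge 2t+3$.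
   Context: $\mathbb{P}^2$ is the projective plane over an algebraically closed field $k$, with homogeneous coordinate ring $R=k[\mathbb{P}^2]$. For a zero-dimensional subscheme $Z\subset\mathbb{P}^2$ with saturated homogeneous ideal $I_Z$, $h_Z(t)=\dim_k(R/I_Z)_t$ and $\Delta h_Z(t)=h_Z(t)-h_Z(t-1)$. For a reduced finite set of points $X$, $2X$ denotes the double point scheme supported on $X$, defined by the saturated ideal $\bigcap_{p\in X}I(p)^2$. *)

theory Defs
  imports
    "HOL-Analysis.Cartesian_Space"
    "HOL-Library.Poly_Mapping"
    "HOL-Library.Numeral_Type"
    "HOL-Algebra.Algebraic_Closure_Type"
    "HOL-Algebra.Embedded_Algebras"
    "HOL-Algebra.Ideal_Product"
    "HOL-Algebra.QuotRing"
begin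

hide_const (open) Divisibility.irreducible
(* HOL-Algebra reserves the name X for the indeterminate of its univariate polynomial rings. *)
no_notation var (\<open>X\<index>\<close>)

text \<open>
  The homogeneous coordinate ring \<open>R = k[x\<^sub>0, x\<^sub>1, x\<^sub>2]\<close> of the projective plane is the
  monoid algebra of the exponent vectors \<open>3 \<Rightarrow>\<^sub>0 nat\<close>. Ideals and quotients of \<open>R\<close> are
  those of HOL-Algebra, for the record \<open>coord_ring\<close> with carrier \<open>UNIV\<close>.
\<close>

type_synonym 'k form_ring = "(3 \<Rightarrow>\<^sub>0 nat) \<Rightarrow>\<^sub>0 'k"

abbreviation coord_ring :: "'k::field form_ring ring"
  where "coord_ring \<equiv> ring_of_type_algebra"

definition forms :: "nat \<Rightarrow> 'k::field form_ring set"
  where "forms d =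
    {f. \<forall>m \<in> Poly_Mapping.keys f. (\<Sum>i\<in>UNIV. Poly_Mapping.lookup m i) = d}"

definition const :: "'k::field \<Rightarrow> 'k form_ring"
  where "const c = Poly_Mapping.single 0 c"

definition eval :: "'k::field form_ring \<Rightarrow> 'k ^ 3 \<Rightarrow> 'k"
  where "eval f v = (\<Sum>m\<in>Poly_Mapping.keys f.
    Poly_Mapping.lookup f m * (\<Prod>i\<in>UNIV. (v $ i) ^ Poly_Mapping.lookup m i))"

definition partial_deriv :: "3 \<Rightarrow> 'k::field form_ring \<Rightarrow> 'k form_ring"
  where "partial_deriv i f = (\<Sum>m\<in>Poly_Mapping.keys f.
    Poly_Mapping.single (m - Poly_Mapping.single i 1)
      (of_nat (Poly_Mapping.lookup m i) * Poly_Mapping.lookup f m))"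

text \<open>Points of the projective plane are the lines through the origin of \<open>k\<^sup>3\<close>.\<close>

definition proj_plane :: "('k::field ^ 3) set set"
  where "proj_plane = {vec.span {v} | v. v \<noteq> 0}"

definition vanishes_at :: "'k::field form_ring \<Rightarrow> ('k ^ 3) set \<Rightarrow> bool"
  where "vanishes_at f p \<longleftrightarrow> (\<forall>v\<in>p. eval f v = 0)"

definition plane_curve :: "'k::field form_ring \<Rightarrow> ('k ^ 3) set set"
  where "plane_curve F = {p \<in> proj_plane. vanishes_at F p}"

text \<open>Jacobian criterion; for an irreducible \<open>F\<close> the curve is the integral scheme defined by \<open>F\<close>.\<close>

definition singular_point :: "'k::field form_ring \<Rightarrow> ('k ^ 3) set \<Rightarrow> bool"
  where "singular_point F p \<longleftrightarrow>
    p \<in> plane_curve F \<and> (\<forall>i. vanishes_at (partial_deriv i F) p)"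

definition point_ideal :: "('k::field ^ 3) set \<Rightarrow> 'k form_ring set"
  where "point_ideal p = genideal coord_ring {f. (\<exists>d. f \<in> forms d) \<and> vanishes_at f p}"

definition double_point_ideal :: "('k::field ^ 3) set set \<Rightarrow> 'k form_ring set"
  where "double_point_ideal X =
    (\<Inter>p\<in>X. ideal_prod coord_ring (point_ideal p) (point_ideal p))"

text \<open>
  \<open>dim\<^sub>k (R/I)\<^sub>t\<close>: the graded piece \<open>(R/I)\<^sub>t\<close> and the field \<open>k\<close> are taken as their images
  (sets of cosets) in the quotient ring.
\<close>

definition hilbert_function :: "'k::field form_ring set \<Rightarrow> nat \<Rightarrow> nat"
  where "hilbert_function I t =
    ring.dim (coord_ring Quot I)
      (range (\<lambda>c. I +>\<^bsub>coord_ring\<^esub> const c)) ((\<lambda>f. I +>\<^bsub>coord_ring\<^esub> f) ` forms t)"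

text \<open>The convention for \<open>i = 0\<close> is that the Hilbert function is 0 in degree \<open>-1\<close>.\<close>

definition hilbert_diff :: "'k::field form_ring set \<Rightarrow> nat \<Rightarrow> int"
  where "hilbert_diff I i = int (hilbert_function I i) -
    (if i = 0 then 0 else int (hilbert_function I (i - 1)))"

end

theory Submission
  imports Defs
begin

text \<open>
  Write \<open>Y = X - {P}\<close>. A form \<open>F H\<close> is double at every point of \<open>X\<close> iff \<open>H\<close> vanishes on \<open>Y\<close>, because
  \<open>F\<close> is itself double at \<open>P\<close> and smooth at the points of \<open>Y\<close>. Hence \<open>dim (I\<^sub>Z)\<^sub>d\<close> is
  \<open>dim (I\<^sub>Y)\<^bsub>d-3\<^esub>\<close> plus the dimension of the restriction of \<open>(I\<^sub>Z)\<^sub>d\<close> to the cubic, and likewise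
  \<open>dim (I\<^sub>Y)\<^sub>e\<close> is \<open>dim R\<^bsub>e-3\<^esub>\<close> plus a restriction term. The cubic is parametrized by the lines through
  \<open>P\<close>: if \<open>F = Z q(X,Y) + k(X,Y)\<close> then \<open>s \<mapsto> (s q(s), q(s), -k(s))\<close>, so restricted forms of degree
  \<open>d\<close> become polynomials of degree at most \<open>3 d\<close>. Those from \<open>I\<^sub>Z\<close> are divisible by
  \<open>q\<^sup>2 \<Prod> (s - s\<^sub>i)\<^sup>2\<close>, and those vanishing at \<open>P\<close> and on \<open>Y\<close> by \<open>q \<Prod> (s - s\<^sub>i)\<close>, which bounds the restriction
  terms from above. Counting conditions (one for each point of \<open>Y\<close>, three for each double point)
  bounds the dimensions from below, and the bounds meet in all degrees except for one unit in degree
  \<open>t + 3\<close> when \<open>\<delta> = 1\<close>, where \<open>Y\<close> may or may not be cut out on the cubic by a curve of degree \<open>t\<close>.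
\<close>

section \<open>Dimensions of subspaces\<close>

text \<open>Let \<open>n = 3 t + \<delta> - 1\<close> be the number of points of \<open>Y\<close>.
  The divisor of the restricted forms in \<open>I_Z\<close> has degree \<open>2 n + 4\<close>, so
  for \<open>3 d \<le> 2 n + 3\<close> every form of degree \<open>d\<close> in \<open>I_Z\<close>
  is a multiple of \<open>F\<close>. For \<open>I_Y\<close> in degree \<open>e\<close> the break is
  at \<open>3 e = n\<close>: below it only multiples of \<open>F\<close> survive, above it the
  points impose independent conditions. With \<open>d = e + 3\<close> the Hilbert function of
  \<open>Z\<close> therefore has slopes 6, 3, 0 from degree 4 on, with breaks at
  \<open>3 d = n + 9\<close> and \<open>3 d = 2 n + 3\<close>. Only for \<open>\<delta> = 1\<close>
  is \<open>n\<close> divisible by 3, so only then can a degree fall exactly on the first break,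
  where the bounds do not decide. The obstacle is that the cubic has arithmetic genus one although
  its parametrization is rational: restricted forms do not fill the space of polynomials of degree
  at most \<open>3 d\<close>, and a naive count is off by one. The factors contributed by
  \<open>P\<close> have to make up for it. Divisibility by the whole polynomial \<open>q\<close>,
  not by its linear factors, treats node and cusp alike. No step divides by an integer of the field,
  so the characteristic is arbitrary.\<close>

context vector_space
begin

text \<open>\<open>dim\<close> counts a basis and is 0 when the basis is infinite, so the larger set
  has to be finitely spanned. All applications stay inside some \<open>forms d\<close>.\<close>

lemma dim_mono_fin:
  assumes "U \<subseteq> V" "V \<subseteq> span W" "finite W"
  shows "dim U \<le> dim V"
proof -
  obtain B where B: "B \<subseteq> V" "independent B" "V \<subseteq> span B" "card B = dim V"
    using basis_exists .
  have "finite B"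
    using independent_span_bound[OF \<open>finite W\<close> B(2)] B(1) assms(2) by blast
  then show ?thesis
    using dim_le_card[of U B] B assms(1) by auto
qed

lemma dim_Ker_functional:
  assumes U: "subspace U" "U \<subseteq> span W" "finite W"
    and f_add: "\<And>x y. f (x + y) = f x + f y"
    and f_scale: "\<And>c x. f (scale c x) = c * f x"
  shows "dim U \<le> dim {x \<in> U. f x = 0} + 1"
proof (cases "\<forall>x\<in>U. f x = 0")
  case True
  then have "{x \<in> U. f x = 0} = U" by auto
  then show ?thesis by simp
next
  case False
  then obtain x0 where x0: "x0 \<in> U" "f x0 \<noteq> 0" by auto
  let ?K = "{x \<in> U. f x = 0}"
  obtain B where B: "B \<subseteq> ?K" "independent B" "?K \<subseteq> span B" "card B = dim ?K"
    using basis_exists .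
  have fin: "finite B"
    using independent_span_bound[OF \<open>finite W\<close> B(2)] B(1) U(2) by blast
  have "U \<subseteq> span (insert x0 B)"
  proof
    fix x assume x: "x \<in> U"
    define c where "c = f x / f x0"
    have fs: "f (x - scale c x0) = 0"
    proof -
      have "f x = f (x - scale c x0) + f (scale c x0)" by (metis f_add diff_add_cancel)
      then show ?thesis using x0 by (simp add: f_scale c_def)
    qed
    have "x - scale c x0 \<in> U"
      using x x0 U(1) by (simp add: subspace_diff subspace_scale)
    with fs have "x - scale c x0 \<in> span B" using B(3) by auto
    then show "x \<in> span (insert x0 B)" by (auto simp: span_insert)
  qed
  then have "dim U \<le> card (insert x0 B)" using dim_le_card fin by blast
  also have "\<dots> \<le> dim ?K + 1" using B(4) fin by (simp add: card_insert_if)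
  finally show ?thesis .
qed

lemma dim_Ker_functionals:
  assumes "finite I" "subspace U" "U \<subseteq> span W" "finite W"
    and f_add: "\<And>i x y. i \<in> I \<Longrightarrow> f i (x + y) = f i x + f i y"
    and f_scale: "\<And>i c x. i \<in> I \<Longrightarrow> f i (scale c x) = c * f i x"
  shows "dim U \<le> dim {x \<in> U. \<forall>i\<in>I. f i x = 0} + card I"
  using assms
proof (induction I arbitrary: U rule: finite_induct)
  case empty
  then show ?case by simp
next
  case (insert j I)
  let ?K = "{x \<in> U. f j x = 0}"
  have f0: "f j 0 = 0" using insert.prems(5)[of j 0 0] by simp
  have sub: "subspace ?K"
    using insert.prems f0 by (intro subspaceI) (auto simp: subspace_0 subspace_add subspace_scale)
  have "dim U \<le> dim ?K + 1"
    using insert.prems by (intro dim_Ker_functional) auto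
  also have "dim ?K \<le> dim {x \<in> ?K. \<forall>i\<in>I. f i x = 0} + card I"
    using insert.prems sub by (intro insert.IH) auto
  also have "{x \<in> ?K. \<forall>i\<in>I. f i x = 0} = {x \<in> U. \<forall>i\<in>insert j I. f i x = 0}" by auto
  finally show ?case using insert.hyps by simp
qed

text \<open>Used in both directions: with the conditions imposed by points as functionals it bounds
  an ideal from below, with the coefficients of the restriction to the curve it bounds the ideal
  from above.\<close>

lemma dim_le_functionals:
  assumes "finite I" "subspace U" "U \<subseteq> span W" "finite W"
    and "\<And>i x y. i \<in> I \<Longrightarrow> f i (x + y) = f i x + f i y"
    and "\<And>i c x. i \<in> I \<Longrightarrow> f i (scale c x) = c * f i x"
    and V: "{x \<in> U. \<forall>i\<in>I. f i x = 0} \<subseteq> V" "V \<subseteq> span W'" "finite W'"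
  shows "dim U \<le> dim V + card I"
  using dim_Ker_functionals[of I U W f] dim_mono_fin[OF V] assms(1-6) by fastforce

lemma dim_inj_image:
  assumes g: "\<And>x y. g (x + y) = g x + g y" "\<And>c x. g (scale c x) = scale c (g x)"
    and inj: "inj_on g U" and U: "subspace U"
  shows "dim (g ` U) = dim U"
proof -
  interpret g: Vector_Spaces.linear scale scale g
    using g by unfold_locales auto
  obtain B where B: "B \<subseteq> U" "independent B" "U \<subseteq> span B" "card B = dim U"
    using basis_exists .
  have eq: "span B = U" using B U by (simp add: span_minimal subset_antisym)
  have "independent (g ` B)"
    using B inj eq by (intro g.independent_injective_image) (auto)
  moreover have "g ` U \<subseteq> span (g ` B)" using g.span_image[of B] eq by simp
  ultimately have "dim (g ` U) = card (g ` B)"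
    using B by (intro dim_unique) auto
  also have "\<dots> = card B" using B(1) inj by (meson card_image inj_on_subset)
  finally show ?thesis using B(4) by simp
qed

text \<open>A basis \<open>B\<close> of \<open>V\<close> is extended to a basis \<open>C\<close> of
  \<open>U\<close>, and \<open>C - B\<close> spans a complement. In the application it represents a
  basis of a graded piece of the quotient ring.\<close>

lemma complement_basis:
  assumes "subspace V" "subspace U" "V \<subseteq> U" "U \<subseteq> span W" "finite W"
  obtains S where "finite S" "S \<subseteq> U" "independent S" "span S \<inter> V = {0}"
    "card S + dim V = dim U" "\<And>x. x \<in> U \<Longrightarrow> \<exists>s\<in>span S. x - s \<in> V"
proof -
  obtain B where B: "B \<subseteq> V" "independent B" "V \<subseteq> span B" "card B = dim V"
    using basis_exists .
  obtain C where C: "B \<subseteq> C" "C \<subseteq> U" "independent C" "U \<subseteq> span C"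
    using maximal_independent_subset_extend[of B U] B assms(3) by blast
  have finC: "finite C" using independent_span_bound[OF \<open>finite W\<close> C(3)] C(2) assms(4) by blast
  have spB: "span B = V" using B assms(1) by (simp add: span_minimal subset_antisym)
  have cU: "card C = dim U" using C basis_card_eq_dim by blast
  have split: "C = (C - B) \<union> B" using C(1) by auto
  show thesis
  proof (rule that[of "C - B"])
    show "finite (C - B)" "C - B \<subseteq> U" using finC C by auto
    show "independent (C - B)" using C(3) independent_mono by blast
    show "card (C - B) + dim V = dim U"
      using cU B(4) finC C(1) by (metis card_Diff_subset card_mono finite_subset le_add_diff_inverse2)
    have "x = 0" if "x \<in> span (C - B)" "x \<in> span B" for x
    proof -
      have finB: "finite B" using finC C(1) finite_subset by blast
      have "x \<in> range (\<lambda>u. \<Sum>b\<in>C-B. scale (u b) b)"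
        using that(1) finC by (metis finite_Diff span_finite)
      then obtain u where u: "x = (\<Sum>b\<in>C-B. scale (u b) b)" by blast
      have "x \<in> range (\<lambda>v. \<Sum>b\<in>B. scale (v b) b)"
        using that(2) finB by (metis span_finite)
      then obtain v where v: "x = (\<Sum>b\<in>B. scale (v b) b)" by blast
      \<comment> \<open>Subtracting the two expansions of \<open>x\<close> gives one relation on all
        of \<open>C\<close>, so every coefficient is 0.\<close>
      let ?w = "\<lambda>b. if b \<in> B then - v b else u b"
      have "(\<Sum>b\<in>C. scale (?w b) b) = (\<Sum>b\<in>C-B. scale (?w b) b) + (\<Sum>b\<in>B. scale (?w b) b)"
        by (rule sum.subset_diff[OF C(1) finC])
      also have "(\<Sum>b\<in>C-B. scale (?w b) b) = (\<Sum>b\<in>C-B. scale (u b) b)"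
        by (rule sum.cong) auto
      also have "(\<Sum>b\<in>B. scale (?w b) b) = - (\<Sum>b\<in>B. scale (v b) b)"
        unfolding sum_negf[symmetric] by (rule sum.cong) auto
      finally have "(\<Sum>b\<in>C. scale (?w b) b) = 0" using u v by simp
      then have "\<forall>b\<in>C. ?w b = 0" using independentD[OF C(3) finC order_refl, of ?w] by blast
      then have "\<forall>b\<in>C-B. u b = 0" by fastforce
      then show ?thesis unfolding u by simp
    qed
    then show "span (C - B) \<inter> V = {0}" using spB span_zero by auto
    show "\<exists>s\<in>span (C - B). x - s \<in> V" if "x \<in> U" for x
    proof -
      have "x \<in> span ((C - B) \<union> B)" using that C split by auto
      then obtain a b where "x = a + b" "a \<in> span (C - B)" "b \<in> span B"
        unfolding span_Un by blast
      then show ?thesis using spB by (intro bexI[of _ a]) auto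
    qed
  qed
qed

end

section \<open>The Hilbert function as a codimension\<close>

lemma const_0 [simp]: "const 0 = 0" and const_1 [simp]: "const 1 = 1"
  by (simp_all add: const_def)

lemma const_add: "const (a + b) = const a + const b"
  by (simp add: const_def single_add)

lemma const_mult: "const (a * b) = const a * const b"
  by (simp add: const_def mult_single)

global_interpretation form_space: vector_space "\<lambda>c (f :: 'k::field form_ring). const c * f"
  by unfold_locales (simp_all add: const_add const_mult algebra_simps)

lemma coord_ring_simps [simp]:
  "carrier coord_ring = UNIV" "x \<otimes>\<^bsub>coord_ring\<^esub> y = x * y" "x \<oplus>\<^bsub>coord_ring\<^esub> y = x + y"
  "\<zero>\<^bsub>coord_ring\<^esub> = 0" "\<one>\<^bsub>coord_ring\<^esub> = 1"
  by (simp_all add: ring_of_type_algebra_def)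

lemma ring_coord_ring: "ring (coord_ring :: 'k::field form_ring ring)"
  and cring_coord_ring: "cring (coord_ring :: 'k form_ring ring)"
  by auto

lemma coord_ring_idealD:
  assumes "ideal I (coord_ring :: 'k::field form_ring ring)"
  shows "0 \<in> I" "\<And>f g. f \<in> I \<Longrightarrow> g \<in> I \<Longrightarrow> f + g \<in> I" "\<And>f g. f \<in> I \<Longrightarrow> g * f \<in> I"
    "\<And>f. f \<in> I \<Longrightarrow> - f \<in> I" "\<And>f g. f \<in> I \<Longrightarrow> g \<in> I \<Longrightarrow> f - g \<in> I"
proof -
  have sub: "additive_subgroup I coord_ring" by (rule ideal.axioms(1)[OF assms])
  show z: "0 \<in> I" using additive_subgroup.zero_closed[OF sub] by simp
  show a: "f + g \<in> I" if "f \<in> I" "g \<in> I" for f g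
    using additive_subgroup.a_closed[OF sub that] by simp
  show m: "g * f \<in> I" if "f \<in> I" for f g
    using ideal.I_l_closed[OF assms that, of g] by simp
  show u: "- f \<in> I" if "f \<in> I" for f using m[OF that, of "-1"] by simp
  show "f - g \<in> I" if "f \<in> I" "g \<in> I" for f g using a[OF that(1) u[OF that(2)]] by simp
qed

lemma coord_ring_idealI:
  assumes "0 \<in> I" "\<And>f g. f \<in> I \<Longrightarrow> g \<in> I \<Longrightarrow> f + g \<in> I" "\<And>f g. f \<in> I \<Longrightarrow> g * f \<in> I"
  shows "ideal I (coord_ring :: 'k::field form_ring ring)"
proof -
  interpret cring "coord_ring :: 'k form_ring ring" by (rule cring_coord_ring)
  have neg: "\<ominus>\<^bsub>coord_ring\<^esub> f = - f" for f :: "'k form_ring"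
    by (rule minus_equality) simp_all
  have "- f \<in> I" if "f \<in> I" for f using assms(3)[OF that, of "-1"] by simp
  then have "subgroup I (add_monoid coord_ring)"
    using assms(1,2) neg by (intro add.subgroupI) (auto simp: a_inv_def[symmetric])
  then show ?thesis
    using assms(3) by (intro idealI ring_coord_ring) (auto simp: mult.commute)
qed

lemma coord_ring_coset_eq_iff:
  assumes "ideal I (coord_ring :: 'k::field form_ring ring)"
  shows "I +>\<^bsub>coord_ring\<^esub> f = I +>\<^bsub>coord_ring\<^esub> g \<longleftrightarrow> f - g \<in> I"
proof -
  note I = coord_ring_idealD[OF assms]
  have coset: "I +>\<^bsub>coord_ring\<^esub> f = {x. x - f \<in> I}" for f
  proof (intro equalityI subsetI)
    fix x assume "x \<in> {x. x - f \<in> I}"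
    then have "x - f \<in> I" "x = (x - f) \<oplus>\<^bsub>coord_ring\<^esub> f" by simp_all
    then show "x \<in> I +>\<^bsub>coord_ring\<^esub> f" unfolding a_r_coset_def' by blast
  qed (auto simp: a_r_coset_def')
  show ?thesis unfolding coset
  proof
    assume "{x. x - f \<in> I} = {x. x - g \<in> I}"
    then have "f \<in> {x. x - g \<in> I}" using I(1) by auto
    then show "f - g \<in> I" by simp
  next
    assume fg: "f - g \<in> I"
    have "x - f \<in> I \<longleftrightarrow> x - g \<in> I" for x
      using I(2)[OF _ fg, of "x - f"] I(5)[OF _ fg, of "x - g"] by auto
    then show "{x. x - f \<in> I} = {x. x - g \<in> I}" by simp
  qed
qed

text \<open>Bridge between two notions of dimension: \<open>ring.dim\<close> over the image of
  \<open>k\<close> inside the quotient ring, and independence in the vector space of polynomials.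
  The condition \<open>1 \<notin> I\<close> makes that image a field.\<close>

lemma hilbert_function_eq_card:
  fixes I :: "'k::field form_ring set"
  assumes I: "ideal I coord_ring" "1 \<notin> I"
    and S: "finite S" "S \<subseteq> forms t" "form_space.independent S"
      "form_space.span S \<inter> I = {0}"
    and span: "form_space.span S \<subseteq> forms t" "\<And>f. f \<in> forms t \<Longrightarrow> \<exists>s\<in>form_space.span S. f - s \<in> I"
  shows "hilbert_function I t = card S"
proof -
  let ?Q = "coord_ring Quot I" and ?pi = "\<lambda>f. I +>\<^bsub>coord_ring\<^esub> f"
  let ?K = "range (\<lambda>c. ?pi (const c))"
  interpret I: ideal I "coord_ring :: 'k form_ring ring" by fact
  interpret Q: ring ?Q by (rule I.quotient_is_ring)
  interpret h: ring_hom_ring coord_ring ?Q ?pi by (rule I.rcos_ring_hom_ring)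
  note eq_iff = coord_ring_coset_eq_iff[OF I(1)]
  have pi_add: "?pi (f + g) = ?pi f \<oplus>\<^bsub>?Q\<^esub> ?pi g" and pi_mult: "?pi (f * g) = ?pi f \<otimes>\<^bsub>?Q\<^esub> ?pi g" for f g
    using h.hom_add[of f g] h.hom_mult[of f g] by simp_all
  have pi_0: "?pi 0 = \<zero>\<^bsub>?Q\<^esub>" and pi_1: "?pi 1 = \<one>\<^bsub>?Q\<^esub>"
    using h.hom_zero h.hom_one by simp_all
  have pi_carrier: "?pi f \<in> carrier ?Q" for f using h.hom_closed[of f] by simp
  let ?k = "ring_of_type_algebra :: 'k ring"
  have "field ?k" ..
  then interpret k: field ?k .
  have hom: "ring_hom_ring ?k ?Q (\<lambda>c. ?pi (const c))"
  proof (rule ring_hom_ringI)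
    show "ring ?k" "ring ?Q" by (rule k.ring_axioms, rule Q.ring_axioms)
  next
    fix x y assume "x \<in> carrier ?k" "y \<in> carrier ?k"
    show "?pi (const (x \<otimes>\<^bsub>?k\<^esub> y)) = ?pi (const x) \<otimes>\<^bsub>?Q\<^esub> ?pi (const y)"
      unfolding pi_mult[symmetric] const_mult[symmetric] by (simp add: ring_of_type_algebra_def)
    show "?pi (const (x \<oplus>\<^bsub>?k\<^esub> y)) = ?pi (const x) \<oplus>\<^bsub>?Q\<^esub> ?pi (const y)"
      unfolding pi_add[symmetric] const_add[symmetric] by (simp add: ring_of_type_algebra_def)
  next
    show "?pi (const \<one>\<^bsub>?k\<^esub>) = \<one>\<^bsub>?Q\<^esub>"
      unfolding pi_1[symmetric] by (simp add: ring_of_type_algebra_def)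
  qed (rule pi_carrier)
  have "\<one>\<^bsub>?Q\<^esub> \<noteq> \<zero>\<^bsub>?Q\<^esub>" using I(2) eq_iff[of 1 0] by (simp flip: pi_0 pi_1)
  then have "subfield ((\<lambda>c. ?pi (const c)) ` carrier ?k) ?Q"
    using ring_hom_ring.img_is_subfield(2)[OF hom k.carrier_is_subfield] by blast
  then have K: "subfield ?K ?Q" by (simp add: ring_of_type_algebra_def)
  \<comment> \<open>\<open>dimension\<close> is an inductive predicate that grows by one line
    extension, so the representatives are adjoined one at a time.\<close>
  have "T \<subseteq> S \<Longrightarrow> Q.dimension (card T) ?K (?pi ` form_space.span T)" if "finite T" for T
    using that
  proof (induction T rule: finite_induct)
    case empty
    then show ?case using Q.zero_dim by (simp add: pi_0)
  next
    case (insert s T)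
    have indep: "s \<notin> form_space.span T"
      using S(3) insert form_space.independent_insert[of s T] form_space.independent_mono by metis
    have "?pi s \<notin> ?pi ` form_space.span T"
    proof
      assume "?pi s \<in> ?pi ` form_space.span T"
      then obtain x where x: "x \<in> form_space.span T" "s - x \<in> I" using eq_iff by auto
      have "s - x \<in> form_space.span S"
        using x(1) insert.prems form_space.span_mono[of T S] form_space.span_base[of s S]
        by (intro form_space.span_diff) auto
      then have "s - x = 0" using S(4) x(2) by blast
      then show False using indep x(1) by simp
    qed
    then have "Q.dimension (Suc (card T)) ?K (Q.line_extension ?K (?pi s) (?pi ` form_space.span T))"
      using insert pi_carrier by (intro Q.Suc_dim) auto
    also have "Q.line_extension ?K (?pi s) (?pi ` form_space.span T) = ?pi ` form_space.span (insert s T)"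
    proof (intro equalityI subsetI)
      fix x assume "x \<in> Q.line_extension ?K (?pi s) (?pi ` form_space.span T)"
      then obtain c y where "y \<in> form_space.span T" "x = ?pi (const c) \<otimes>\<^bsub>?Q\<^esub> ?pi s \<oplus>\<^bsub>?Q\<^esub> ?pi y"
        unfolding Q.line_extension_mem_iff by auto
      then show "x \<in> ?pi ` form_space.span (insert s T)"
        by (auto simp: form_space.span_insert pi_add[symmetric] pi_mult[symmetric]
            intro!: imageI exI[of _ c])
    next
      fix x assume "x \<in> ?pi ` form_space.span (insert s T)"
      then obtain c z where z: "z - const c * s \<in> form_space.span T" "x = ?pi z"
        by (auto simp: form_space.span_insert)
      have "x = ?pi (const c) \<otimes>\<^bsub>?Q\<^esub> ?pi s \<oplus>\<^bsub>?Q\<^esub> ?pi (z - const c * s)"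
        unfolding pi_add[symmetric] pi_mult[symmetric] z(2) by simp
      with z(1) show "x \<in> Q.line_extension ?K (?pi s) (?pi ` form_space.span T)"
        unfolding Q.line_extension_mem_iff by blast
    qed
    finally show ?case using insert by simp
  qed
  from this[OF S(1)] have "Q.dimension (card S) ?K (?pi ` form_space.span S)" by simp
  moreover have "?pi ` form_space.span S = ?pi ` forms t"
    using span eq_iff by (auto simp: image_iff)
  ultimately show ?thesis
    using Q.dimI[OF K] by (simp add: hilbert_function_def over_def)
qed

section \<open>Graded pieces of the coordinate ring and their dimensions\<close>

lemma forms_0 [simp]: "0 \<in> forms d"
  by (simp add: forms_def)

lemma forms_add: "f \<in> forms d \<Longrightarrow> g \<in> forms d \<Longrightarrow> f + g \<in> forms d"
  using keys_add[of f g] by (auto simp: forms_def)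

lemma forms_mult:
  assumes "f \<in> forms d" "g \<in> forms e"
  shows "f * g \<in> forms (d + e)"
proof -
  have "(\<Sum>i\<in>UNIV. Poly_Mapping.lookup m i) = d + e" if m: "m \<in> Poly_Mapping.keys (f * g)" for m
  proof -
    obtain a b where "m = a + b" "a \<in> Poly_Mapping.keys f" "b \<in> Poly_Mapping.keys g" using m keys_mult[of f g] by blast
    then show ?thesis using assms by (auto simp: forms_def lookup_add sum.distrib)
  qed
  then show ?thesis by (simp add: forms_def)
qed

lemma const_in_forms: "const c \<in> forms 0"
  by (simp add: forms_def const_def)

lemma forms_const_mult: "f \<in> forms d \<Longrightarrow> const c * f \<in> forms d"
  using forms_mult[OF const_in_forms, of f d c] by simp

lemma subspace_forms: "form_space.subspace (forms d)"
  by (intro form_space.subspaceI) (auto simp: forms_add forms_const_mult)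

lemma forms_sum: "(\<And>i. i \<in> I \<Longrightarrow> f i \<in> forms d) \<Longrightarrow> (\<Sum>i\<in>I. f i) \<in> forms d"
  by (rule form_space.subspace_sum[OF subspace_forms])

lemma forms_power: "f \<in> forms d \<Longrightarrow> f ^ n \<in> forms (n * d)"
proof (induction n)
  case 0
  show ?case using const_in_forms[of 1] by simp
next
  case (Suc n)
  show ?case using forms_mult[OF Suc.prems Suc.IH[OF Suc.prems]] by simp
qed

definition monomials :: "nat \<Rightarrow> (3 \<Rightarrow>\<^sub>0 nat) set"
  where "monomials d = {m. (\<Sum>i\<in>UNIV. Poly_Mapping.lookup m i) = d}"

lemma bij_monomials:
  "bij_betw (\<lambda>m. (Poly_Mapping.lookup m 1, Poly_Mapping.lookup m 2)) (monomials d) {(i, j). i + j \<le> d}"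
  unfolding bij_betw_def
proof
  show "inj_on (\<lambda>m. (Poly_Mapping.lookup m 1, Poly_Mapping.lookup m 2)) (monomials d)"
  proof (rule inj_onI)
    fix m m' assume *: "m \<in> monomials d" "m' \<in> monomials d"
      "(Poly_Mapping.lookup m 1, Poly_Mapping.lookup m 2) = (Poly_Mapping.lookup m' 1, Poly_Mapping.lookup m' 2)"
    then have "\<forall>i. Poly_Mapping.lookup m i = Poly_Mapping.lookup m' i"
      unfolding forall_3 monomials_def sum_3 by simp
    then show "m = m'" by (intro poly_mapping_eqI) simp
  qed
  show "(\<lambda>m. (Poly_Mapping.lookup m 1, Poly_Mapping.lookup m 2)) ` monomials d = {(i, j). i + j \<le> d}"
  proof (intro equalityI subsetI)
    fix x assume "x \<in> {(i, j). i + j \<le> d}"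
    then obtain i j where x: "x = (i, j)" "i + j \<le> d" by auto
    let ?m = "Poly_Mapping.single 1 i + Poly_Mapping.single 2 j + Poly_Mapping.single 3 (d - i - j) :: 3 \<Rightarrow>\<^sub>0 nat"
    have *: "Poly_Mapping.lookup ?m 1 = i" "Poly_Mapping.lookup ?m 2 = j" "Poly_Mapping.lookup ?m 3 = d - i - j"
      by (simp_all add: lookup_add lookup_single)
    then have "?m \<in> monomials d" using x unfolding monomials_def sum_3 by simp
    then show "x \<in> (\<lambda>m. (Poly_Mapping.lookup m 1, Poly_Mapping.lookup m 2)) ` monomials d"
      using x * by (metis (no_types, lifting) image_eqI)
  next
    fix x assume "x \<in> (\<lambda>m. (Poly_Mapping.lookup m 1, Poly_Mapping.lookup m 2)) ` monomials d"
    then show "x \<in> {(i, j). i + j \<le> d}" unfolding monomials_def sum_3 by auto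
  qed
qed

lemma card_monomials: "finite (monomials d)" "2 * card (monomials d) = (d + 1) * (d + 2)"
proof -
  let ?T = "{(i, j). i + j \<le> d}"
  have T: "?T = (SIGMA i:{..d}. {..d - i})" by auto
  have "finite ?T" unfolding T by simp
  then show "finite (monomials d)" using bij_monomials bij_betw_finite by blast
  have "card (monomials d) = card ?T" using bij_betw_same_card[OF bij_monomials] .
  also have "\<dots> = (\<Sum>i\<le>d. d - i + 1)" unfolding T by (subst card_SigmaI) auto
  also have "\<dots> = (\<Sum>i\<le>d. i + 1)"
    by (rule sum.reindex_bij_witness[of _ "\<lambda>i. d - i" "\<lambda>i. d - i"]) auto
  finally have "2 * card (monomials d) = 2 * (\<Sum>i\<le>d. i + 1)" by simp
  also have "2 * (\<Sum>i\<le>d. i + 1) = (d + 1) * (d + 2)"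
    by (induction d) (auto simp: algebra_simps)
  finally show "2 * card (monomials d) = (d + 1) * (d + 2)" .
qed

lemma form_space_basis:
  fixes d :: nat
  defines "B \<equiv> (\<lambda>m. Poly_Mapping.single m (1 :: 'k::field)) ` monomials d"
  shows "finite B" "form_space.span B = forms d" "2 * form_space.dim (forms d :: 'k form_ring set) = (d + 1) * (d + 2)"
proof -
  show fin: "finite B" unfolding B_def using card_monomials(1) by (rule finite_imageI)
  have sub: "B \<subseteq> forms d" by (auto simp: B_def forms_def monomials_def)
  have "f \<in> form_space.span B" if f: "f \<in> forms d" for f :: "'k form_ring"
  proof -
    have "f = (\<Sum>m\<in>Poly_Mapping.keys f. Poly_Mapping.single m (Poly_Mapping.lookup f m))"
      by (rule poly_mapping_eqI) (simp add: lookup_sum lookup_single when_def in_keys_iff sum.delta)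
    also have "\<dots> = (\<Sum>m\<in>Poly_Mapping.keys f. const (Poly_Mapping.lookup f m) * Poly_Mapping.single m 1)"
      by (simp add: const_def mult_single)
    also have "\<dots> \<in> form_space.span B"
      using f by (intro form_space.span_sum form_space.span_scale form_space.span_base)
        (auto simp: B_def forms_def monomials_def)
    finally show ?thesis .
  qed
  then show span: "form_space.span B = forms d"
    using form_space.span_minimal[OF sub subspace_forms] by blast
  have inj: "inj_on (\<lambda>m. Poly_Mapping.single m (1 :: 'k)) (monomials d)"
  proof (rule inj_onI)
    fix m m' assume "Poly_Mapping.single m (1 :: 'k) = Poly_Mapping.single m' 1"
    then have "Poly_Mapping.lookup (Poly_Mapping.single m (1 :: 'k)) m = Poly_Mapping.lookup (Poly_Mapping.single m' 1) m"
      by simp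
    then show "m = m'" by (simp add: lookup_single when_def split: if_splits)
  qed
  have "form_space.independent B"
  proof (rule form_space.independent_if_scalars_zero[OF fin])
    fix g b assume s: "(\<Sum>x\<in>B. const (g x) * x) = 0" and b: "b \<in> B"
    then obtain m where m: "b = Poly_Mapping.single m 1" "m \<in> monomials d" by (auto simp: B_def)
    have "0 = (\<Sum>x\<in>B. const (g x) * x)" using s by simp
    also have "\<dots> = (\<Sum>m\<in>monomials d. Poly_Mapping.single m (g (Poly_Mapping.single m 1)))"
      unfolding B_def using inj by (simp add: sum.reindex const_def mult_single)
    finally have "Poly_Mapping.lookup (\<Sum>m\<in>monomials d. Poly_Mapping.single m (g (Poly_Mapping.single m 1))) m = 0"
      by simp
    then show "g b = 0"
      using m card_monomials(1) by (simp add: lookup_sum lookup_single when_def sum.delta)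
  qed
  then have "form_space.dim (forms d :: 'k form_ring set) = card B"
    using span sub form_space.dim_unique[of B "forms d"] by auto
  also have "\<dots> = card (monomials d)" unfolding B_def using inj by (rule card_image)
  finally show "2 * form_space.dim (forms d :: 'k form_ring set) = (d + 1) * (d + 2)"
    using card_monomials(2) by simp
qed

lemma forms_fin_spanned: obtains B where "finite B" "(forms d :: 'k::field form_ring set) \<subseteq> form_space.span B"
  using form_space_basis(1,2) by (metis order_refl)

lemma subspace_ideal_forms:
  assumes "ideal I (coord_ring :: 'k::field form_ring ring)"
  shows "form_space.subspace (I \<inter> forms d)"
  using coord_ring_idealD[OF assms]
  by (intro form_space.subspaceI) (auto simp: forms_add forms_const_mult)

text \<open>A complement of \<open>I \<inter> forms d\<close> in \<open>forms d\<close> maps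
  bijectively onto the graded piece of the quotient.\<close>

lemma hilbert_function_eq_dim:
  assumes I: "ideal I (coord_ring :: 'k::field form_ring ring)" "1 \<notin> I"
  shows "hilbert_function I d + form_space.dim (I \<inter> forms d) = form_space.dim (forms d :: 'k form_ring set)"
proof -
  obtain B where B: "finite B" "(forms d :: 'k form_ring set) \<subseteq> form_space.span B"
    using forms_fin_spanned .
  obtain S where S: "finite S" "S \<subseteq> forms d" "form_space.independent S"
    "form_space.span S \<inter> (I \<inter> forms d) = {0}"
    "card S + form_space.dim (I \<inter> forms d) = form_space.dim (forms d :: 'k form_ring set)"
    "\<And>x. x \<in> forms d \<Longrightarrow> \<exists>s\<in>form_space.span S. x - s \<in> I \<inter> forms d"
    using form_space.complement_basis[OF subspace_ideal_forms[OF I(1)] subspace_forms _ B(2,1)]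
    by blast
  have sp: "form_space.span S \<subseteq> forms d"
    using form_space.span_minimal[OF S(2) subspace_forms] .
  have "hilbert_function I d = card S"
  proof (rule hilbert_function_eq_card[OF I S(1-3) _ sp])
    show "form_space.span S \<inter> I = {0}" using S(4) sp by blast
    show "\<exists>s\<in>form_space.span S. f - s \<in> I" if "f \<in> forms d" for f using S(6)[OF that] by blast
  qed
  then show ?thesis using S(5) by simp
qed

section \<open>Substitution homomorphisms and point ideals\<close>

no_notation fps_nth (infixl "$" 75)

text \<open>One homomorphism for two uses: with \<open>\<iota>\<close> the identity it is evaluation
  at a vector, with \<open>\<iota>\<close> the constant polynomials it is restriction to a
  parametrized curve.\<close>

definition subst :: "('k::field \<Rightarrow> 'b::comm_ring_1) \<Rightarrow> (3 \<Rightarrow> 'b) \<Rightarrow> 'k form_ring \<Rightarrow> 'b"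
  where "subst \<iota> y f = (\<Sum>m\<in>Poly_Mapping.keys f.
    \<iota> (Poly_Mapping.lookup f m) * (\<Prod>i\<in>UNIV. y i ^ Poly_Mapping.lookup m i))"

definition var :: "3 \<Rightarrow> 'k::field form_ring"
  where "var i = Poly_Mapping.single (Poly_Mapping.single i 1) 1"

lemma var_in_forms: "var i \<in> forms 1"
  by (simp add: forms_def var_def lookup_single when_def)

lemma sum_single_decomp:
  fixes f :: "'a \<Rightarrow>\<^sub>0 'b::comm_monoid_add"
  shows "(\<Sum>m\<in>Poly_Mapping.keys f. Poly_Mapping.single m (Poly_Mapping.lookup f m)) = f"
  by (rule poly_mapping_eqI) (simp add: lookup_sum lookup_single when_def in_keys_iff sum.delta)

locale coeff_hom =
  fixes \<iota> :: "'k::field \<Rightarrow> 'b::comm_ring_1"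
  assumes hom_0: "\<iota> 0 = 0" and hom_1: "\<iota> 1 = 1"
    and hom_add: "\<iota> (a + b) = \<iota> a + \<iota> b" and hom_mult: "\<iota> (a * b) = \<iota> a * \<iota> b"
begin

lemma subst_superset:
  assumes "finite S" "Poly_Mapping.keys f \<subseteq> S"
  shows "subst \<iota> y f = (\<Sum>m\<in>S. \<iota> (Poly_Mapping.lookup f m) * (\<Prod>i\<in>UNIV. y i ^ Poly_Mapping.lookup m i))"
  unfolding subst_def using assms
  by (intro sum.mono_neutral_left) (auto simp: in_keys_iff hom_0)

lemma subst_add: "subst \<iota> y (f + g) = subst \<iota> y f + subst \<iota> y g"
proof -
  let ?S = "Poly_Mapping.keys f \<union> Poly_Mapping.keys g"
  have "finite ?S" "Poly_Mapping.keys (f + g) \<subseteq> ?S" "Poly_Mapping.keys f \<subseteq> ?S" "Poly_Mapping.keys g \<subseteq> ?S"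
    using keys_add[of f g] by auto
  note * = subst_superset[OF this(1,2)] subst_superset[OF this(1,3)] subst_superset[OF this(1,4)]
  show ?thesis unfolding * by (simp add: lookup_add hom_add algebra_simps sum.distrib)
qed

lemma subst_0: "subst \<iota> y 0 = 0"
  by (simp add: subst_def)

lemma subst_sum: "subst \<iota> y (\<Sum>i\<in>I. f i) = (\<Sum>i\<in>I. subst \<iota> y (f i))"
  by (induction I rule: infinite_finite_induct) (simp_all add: subst_0 subst_add)

lemma subst_single: "subst \<iota> y (Poly_Mapping.single m c) = \<iota> c * (\<Prod>i\<in>UNIV. y i ^ Poly_Mapping.lookup m i)"
  by (simp add: subst_def hom_0)

lemma subst_const: "subst \<iota> y (const c) = \<iota> c"
  by (simp add: const_def subst_single)

lemma subst_1: "subst \<iota> y 1 = 1"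
  using subst_const[of y 1] by (simp add: hom_1)

lemma subst_var: "subst \<iota> y (var i) = y i"
  using exhaust_3[of i] unfolding var_def subst_single UNIV_3 by (auto simp: hom_1 lookup_single)

lemma subst_mult: "subst \<iota> y (f * g) = subst \<iota> y f * subst \<iota> y g"
proof -
  have s: "subst \<iota> y (Poly_Mapping.single m a * Poly_Mapping.single n b)
      = subst \<iota> y (Poly_Mapping.single m a) * subst \<iota> y (Poly_Mapping.single n b)" for m n a b
    unfolding mult_single subst_single
    by (simp add: hom_mult lookup_add power_add prod.distrib algebra_simps)
  let ?s = "\<lambda>f. \<Sum>m\<in>Poly_Mapping.keys f. Poly_Mapping.single m (Poly_Mapping.lookup f m)"
  have "subst \<iota> y (?s f * ?s g) = subst \<iota> y (?s f) * subst \<iota> y (?s g)"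
    unfolding sum_product subst_sum s ..
  then show ?thesis unfolding sum_single_decomp .
qed

lemma subst_uminus: "subst \<iota> y (- f) = - subst \<iota> y f"
  using subst_add[of y "- f" f] by (simp add: subst_0 add_eq_0_iff2)

lemma subst_diff: "subst \<iota> y (f - g) = subst \<iota> y f - subst \<iota> y g"
  using subst_add[of y f "- g"] by (simp add: subst_uminus)

lemma subst_power: "subst \<iota> y (f ^ n) = subst \<iota> y f ^ n"
  by (induction n) (simp_all add: subst_1 subst_mult)

lemma subst_scale:
  assumes "f \<in> forms d"
  shows "subst \<iota> (\<lambda>i. c * y i) f = c ^ d * subst \<iota> y f"
proof -
  have "(\<Prod>i\<in>UNIV. (c * y i) ^ Poly_Mapping.lookup m i) = c ^ d * (\<Prod>i\<in>UNIV. y i ^ Poly_Mapping.lookup m i)"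
    if "m \<in> Poly_Mapping.keys f" for m
  proof -
    have "(\<Sum>i\<in>UNIV. Poly_Mapping.lookup m i) = d" using assms that by (simp add: forms_def)
    then have "c ^ d = (\<Prod>i\<in>UNIV. c ^ Poly_Mapping.lookup m i)" by (auto simp: power_sum)
    then show ?thesis by (simp add: power_mult_distrib prod.distrib)
  qed
  then show ?thesis
    unfolding subst_def sum_distrib_left by (intro sum.cong) (auto simp: algebra_simps)
qed

end

lemma single_eq_prod_var:
  "Poly_Mapping.single m (c :: 'k::field) = const c * (\<Prod>i\<in>UNIV. var i ^ Poly_Mapping.lookup m i)"
proof -
  have p: "(var i :: 'k form_ring) ^ n = Poly_Mapping.single (Poly_Mapping.single i n) 1" for i n
  proof (induction n)
    case (Suc n)
    have "(var i :: 'k form_ring) ^ Suc n = var i * Poly_Mapping.single (Poly_Mapping.single i n) 1"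
      by (simp add: Suc)
    also have "\<dots> = Poly_Mapping.single (Poly_Mapping.single i 1 + Poly_Mapping.single i n) (1 * 1)"
      unfolding var_def mult_single ..
    also have "Poly_Mapping.single i 1 + Poly_Mapping.single i n = Poly_Mapping.single i (Suc n)"
      by (simp flip: single_add)
    finally show ?case by simp
  qed simp
  have "m = Poly_Mapping.single 1 (Poly_Mapping.lookup m 1) + Poly_Mapping.single 2 (Poly_Mapping.lookup m 2)
      + Poly_Mapping.single 3 (Poly_Mapping.lookup m 3)" (is "m = ?m")
  proof -
    have "\<forall>i. Poly_Mapping.lookup m i = Poly_Mapping.lookup ?m i"
      unfolding forall_3 by (simp add: lookup_add lookup_single)
    then show ?thesis by (intro poly_mapping_eqI) (rule spec)
  qed
  moreover have "(\<Prod>i\<in>UNIV. (var i :: 'k form_ring) ^ Poly_Mapping.lookup m i) = Poly_Mapping.single ?m 1"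
    unfolding UNIV_3 by (simp add: p mult_single add.assoc)
  ultimately show ?thesis by (simp add: const_def mult_single)
qed

lemma form_induct [case_names const var add mult]:
  assumes "\<And>c. P (const c)" "\<And>i. P (var i)"
    "\<And>f g. P f \<Longrightarrow> P g \<Longrightarrow> P (f + g)" "\<And>f g. P f \<Longrightarrow> P g \<Longrightarrow> P (f * g)"
  shows "P (f :: 'k::field form_ring)"
proof -
  have P0: "P 0" and P1: "P 1" using assms(1)[of 0] assms(1)[of 1] by simp_all
  have pow: "P ((var i :: 'k form_ring) ^ n)" for i n
    by (induction n) (simp_all add: P1 assms(2,4))
  have "P (\<Prod>i\<in>A. var i ^ Poly_Mapping.lookup m i)" for m A
    by (induction A rule: infinite_finite_induct) (simp_all add: P1 pow assms(4))
  then have "P (Poly_Mapping.single m c)" for m c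
    unfolding single_eq_prod_var by (intro assms(1,4))
  then have "P (\<Sum>m\<in>A. Poly_Mapping.single m (Poly_Mapping.lookup f m))" for A
    by (induction A rule: infinite_finite_induct) (simp_all add: P0 assms(3))
  then show ?thesis using sum_single_decomp[of f] by metis
qed

lemma coeff_hom_id: "coeff_hom (\<lambda>c :: 'k::field. c)"
  by unfold_locales simp_all

lemma coeff_hom_poly: "coeff_hom (\<lambda>c :: 'k::field. [:c:])"
  by unfold_locales (simp_all add: one_pCons)

lemma eval_conv_subst: "eval f v = subst (\<lambda>c. c) (\<lambda>i. v $ i) f"
  by (simp add: eval_def subst_def)

interpretation eval_hom: coeff_hom "\<lambda>c :: 'k::field. c"
  by (rule coeff_hom_id)

interpretation psubst: coeff_hom "\<lambda>c :: 'k::field. [:c:]"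
  by (rule coeff_hom_poly)

abbreviation psubst :: "(3 \<Rightarrow> 'k::field poly) \<Rightarrow> 'k form_ring \<Rightarrow> 'k poly"
  where "psubst \<equiv> subst (\<lambda>c. [:c:])"

lemmas eval_simps = eval_conv_subst eval_hom.subst_add eval_hom.subst_0 eval_hom.subst_1 eval_hom.subst_mult
  eval_hom.subst_const eval_hom.subst_var eval_hom.subst_uminus eval_hom.subst_diff eval_hom.subst_power
  eval_hom.subst_sum

lemmas psubst_simps = psubst.subst_add psubst.subst_0 psubst.subst_1 psubst.subst_mult
  psubst.subst_const psubst.subst_var psubst.subst_uminus psubst.subst_diff psubst.subst_power
  psubst.subst_sum

lemma poly_psubst: "poly (psubst y f) s = eval f (\<chi> i. poly (y i) s)"
  by (induction f rule: form_induct) (simp_all add: psubst_simps eval_simps)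

lemma psubst_const_vec: "psubst (\<lambda>i. [:a $ i:]) f = [:eval f a:]"
  by (induction f rule: form_induct) (simp_all add: psubst_simps eval_simps)

lemma psubst_cong_dvd:
  assumes "\<And>i. h dvd y i - z i"
  shows "h dvd psubst y f - psubst z f"
proof (induction f rule: form_induct)
  case (add f g)
  have "psubst y (f + g) - psubst z (f + g) = (psubst y f - psubst z f) + (psubst y g - psubst z g)"
    by (simp add: psubst_simps)
  then show ?case using add by (metis dvd_add)
next
  case (mult f g)
  have "psubst y (f * g) - psubst z (f * g) = (psubst y f - psubst z f) * psubst y g + psubst z f * (psubst y g - psubst z g)"
    by (simp add: psubst_simps algebra_simps)
  then show ?case using mult by (metis dvd_add dvd_mult dvd_mult2)
qed (use assms in \<open>simp_all add: psubst_simps\<close>)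

lemma degree_psubst_le:
  assumes "f \<in> forms d" "\<And>i. degree (y i) \<le> e"
  shows "degree (psubst y f) \<le> d * e"
  unfolding subst_def
proof (rule degree_sum_le)
  fix m assume m: "m \<in> Poly_Mapping.keys f"
  have "degree (\<Prod>i\<in>UNIV. y i ^ Poly_Mapping.lookup m i) \<le> (\<Sum>i\<in>UNIV. degree (y i ^ Poly_Mapping.lookup m i))"
    using degree_prod_sum_le[of UNIV "\<lambda>i. y i ^ Poly_Mapping.lookup m i"] by (simp add: comp_def)
  also have "\<dots> \<le> (\<Sum>i\<in>UNIV. Poly_Mapping.lookup m i * e)"
    by (intro sum_mono order.trans[OF degree_power_le]) (simp add: assms(2))
  also have "\<dots> = d * e" using assms(1) m by (simp add: forms_def flip: sum_distrib_right)
  finally show "degree ([:Poly_Mapping.lookup f m:] * (\<Prod>i\<in>UNIV. y i ^ Poly_Mapping.lookup m i)) \<le> d * e"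
    by (simp add: degree_smult_le[THEN order.trans])
qed simp

lemma eval_scale: "f \<in> forms d \<Longrightarrow> eval f (c *s a) = c ^ d * eval f a"
  using eval_hom.subst_scale[of f d c "\<lambda>i. a $ i"] by (simp add: eval_conv_subst)

lemma vanishes_at_span:
  assumes "f \<in> forms d"
  shows "vanishes_at f (vec.span {a}) \<longleftrightarrow> eval f a = 0"
  using vec.span_base[of a "{a}"] eval_scale[OF assms, of _ a]
  by (auto simp: vanishes_at_def vec.span_singleton)

lemma point_ideal_is_ideal: "ideal (point_ideal p) (coord_ring :: 'k::field form_ring ring)"
  unfolding point_ideal_def by (rule ring.genideal_ideal[OF ring_coord_ring]) simp

lemma point_ideal_span_memI:
  assumes "f \<in> forms d" "eval f a = 0"
  shows "f \<in> point_ideal (vec.span {a})"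
proof -
  let ?S = "{f. (\<exists>d. f \<in> forms d) \<and> vanishes_at f (vec.span {a})}"
  have "f \<in> ?S" using assms vanishes_at_span by blast
  moreover have "?S \<subseteq> genideal coord_ring ?S" by (rule ring.genideal_self[OF ring_coord_ring]) simp
  ultimately show ?thesis unfolding point_ideal_def by (rule subsetD[rotated])
qed

text \<open>Modulo \<open>h\<close> the curve \<open>y\<close> is the fixed point \<open>a\<close>
  up to the scalar \<open>e\<close>, so a form of degree \<open>d\<close> vanishing at
  \<open>a\<close> restricts to \<open>e ^ d\<close> times 0. The scalar may itself be a polynomial,
  because only the projective point matters; this is what allows all branches at the singular point
  to be treated at once.\<close>

lemma point_ideal_psubst_dvd:
  assumes y: "\<And>i. h dvd y i - e * [:a $ i:]" and f: "f \<in> point_ideal (vec.span {a})"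
  shows "h dvd psubst y f"
proof -
  let ?J = "{f. h dvd psubst y f}"
  have J: "ideal ?J coord_ring"
    by (rule coord_ring_idealI) (simp_all add: psubst_simps)
  have "point_ideal (vec.span {a}) \<subseteq> ?J"
    unfolding point_ideal_def
  proof (rule ring.genideal_minimal[OF ring_coord_ring J], clarify)
    fix g d assume g: "g \<in> forms d" "vanishes_at g (vec.span {a})"
    have "psubst (\<lambda>i. e * [:a $ i:]) g = e ^ d * [:eval g a:]"
      unfolding psubst.subst_scale[OF g(1)] psubst_const_vec ..
    moreover have "eval g a = 0" using g(2) unfolding vanishes_at_span[OF g(1)] .
    ultimately have "psubst (\<lambda>i. e * [:a $ i:]) g = 0" by simp
    then show "h dvd psubst y g" using psubst_cong_dvd[of h y "\<lambda>i. e * [:a $ i:]" g, OF y] by (simp only: diff_zero)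
  qed
  then show ?thesis using f by blast
qed

lemma square_ideal_is_ideal:
  "ideal (ideal_prod coord_ring (point_ideal p) (point_ideal p)) (coord_ring :: 'k::field form_ring ring)"
  by (rule ring.ideal_prod_is_ideal[OF ring_coord_ring point_ideal_is_ideal point_ideal_is_ideal])

lemma double_point_ideal_psubst_dvd:
  assumes "\<And>i. h dvd y i - e * [:a $ i:]"
    and "f \<in> ideal_prod coord_ring (point_ideal (vec.span {a})) (point_ideal (vec.span {a}))"
  shows "h\<^sup>2 dvd psubst y f"
  using assms(2)
proof (induction f rule: ideal_prod.induct)
  case (prod f g)
  then show ?case
    using point_ideal_psubst_dvd[OF assms(1)] by (simp add: psubst_simps power2_eq_square mult_dvd_mono)
next
  case (sum f g)
  then show ?case by (simp add: psubst_simps)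
qed

section \<open>First-order expansion along a line\<close>

lemma coeff_1_mult: "coeff (p * q) (Suc 0) = coeff p 0 * coeff q (Suc 0) + coeff p (Suc 0) * coeff q 0"
  by (simp add: coeff_mult)

lemma coeff_1_linear_power:
  "coeff ([:a, b:] ^ n) (Suc 0) = of_nat n * b * a ^ (n - 1)" for a b :: "'k::field"
proof (induction n)
  case (Suc n)
  have "coeff ([:a, b:] ^ Suc n) (Suc 0) = a * (of_nat n * b * a ^ (n - 1)) + b * a ^ n"
    unfolding power_Suc coeff_1_mult Suc by (simp add: coeff_0_power)
  also have "\<dots> = of_nat (Suc n) * b * a ^ n"
    by (cases n) (simp_all add: algebra_simps)
  finally show ?case by simp
qed simp

lemma coeff_psubst_line_0: "coeff (psubst (\<lambda>i. [:a $ i, b $ i:]) f) 0 = eval f a"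
  using poly_psubst[of "\<lambda>i. [:a $ i, b $ i:]" f 0] by (simp add: poly_0_coeff_0 vec_lambda_eta)

text \<open>The chain rule for formal derivatives, valid in every characteristic. It turns the
  Jacobian criterion into a statement about restrictions to lines.\<close>

lemma coeff_psubst_line_1:
  "coeff (psubst (\<lambda>i. [:a $ i, b $ i:]) f) 1 = (\<Sum>i\<in>UNIV. b $ i * eval (partial_deriv i f) a)"
proof -
  let ?M = "\<lambda>m. \<Prod>j\<in>UNIV. [:a $ j, b $ j:] ^ Poly_Mapping.lookup m j"
  let ?D = "\<lambda>i m. \<Prod>j\<in>UNIV. (a $ j) ^ Poly_Mapping.lookup (m - Poly_Mapping.single i 1) j"
  \<comment> \<open>If \<open>x_i\<close> does not occur in the monomial, the exponent in
    \<open>?D\<close> is truncated, but the factor \<open>of_nat 0\<close> removes that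
    summand.\<close>
  have mono: "coeff (?M m) 1 = (\<Sum>i\<in>UNIV. b $ i * (of_nat (Poly_Mapping.lookup m i) * ?D i m))" for m
    unfolding UNIV_3
    by (simp add: coeff_1_mult coeff_1_linear_power coeff_0_power coeff_mult_0 lookup_minus lookup_single algebra_simps)
  have ev: "eval (partial_deriv i f) a = (\<Sum>m\<in>Poly_Mapping.keys f.
      of_nat (Poly_Mapping.lookup m i) * Poly_Mapping.lookup f m * ?D i m)" for i
    by (simp add: partial_deriv_def eval_conv_subst eval_hom.subst_sum eval_hom.subst_single)
  have "coeff (psubst (\<lambda>i. [:a $ i, b $ i:]) f) 1 = (\<Sum>m\<in>Poly_Mapping.keys f. Poly_Mapping.lookup f m * coeff (?M m) 1)"
    by (simp add: subst_def coeff_sum)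
  also have "\<dots> = (\<Sum>m\<in>Poly_Mapping.keys f. \<Sum>i\<in>UNIV.
      b $ i * (of_nat (Poly_Mapping.lookup m i) * Poly_Mapping.lookup f m * ?D i m))"
    unfolding mono sum_distrib_left by (intro sum.cong refl) (simp add: algebra_simps)
  also have "\<dots> = (\<Sum>i\<in>UNIV. b $ i * eval (partial_deriv i f) a)"
    unfolding ev sum_distrib_left by (rule sum.swap)
  finally show ?thesis .
qed

section \<open>Coordinates adapted to a point\<close>

definition dot :: "'k::field ^ 3 \<Rightarrow> 'k ^ 3 \<Rightarrow> 'k"
  where "dot a b = (\<Sum>i\<in>UNIV. a $ i * b $ i)"

definition linear_form :: "'k::field ^ 3 \<Rightarrow> 'k form_ring"
  where "linear_form a = (\<Sum>i\<in>UNIV. const (a $ i) * var i)"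

lemma linear_form_in_forms: "linear_form a \<in> forms 1"
  unfolding linear_form_def by (intro forms_sum forms_const_mult var_in_forms)

lemma eval_linear_form: "eval (linear_form a) b = dot a b"
  by (simp add: linear_form_def dot_def eval_simps)

lemma psubst_linear_form: "psubst y (linear_form a) = (\<Sum>i\<in>UNIV. [:a $ i:] * y i)"
  by (simp add: linear_form_def psubst_simps)

lemma psubst_line_linear_form:
  "psubst (\<lambda>i. [:a $ i, b $ i:]) (linear_form c) = [:dot c a, dot c b:]"
  unfolding psubst_linear_form dot_def sum_3 by simp

text \<open>\<open>dual\<close> and \<open>complete\<close> are the two products of a matrix with
  its inverse. The first evaluates the new coordinates on vectors, the second rewrites the old
  variables in the new ones. The point \<open>w\<close> becomes \<open>X = Y = 0\<close>.\<close>

locale plane_coords =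
  fixes u v w :: "'k::field ^ 3" and xs ys zs :: "'k ^ 3"
  assumes dual: "dot xs u = 1" "dot xs v = 0" "dot xs w = 0"
    "dot ys u = 0" "dot ys v = 1" "dot ys w = 0"
    "dot zs u = 0" "dot zs v = 0" "dot zs w = 1"
    and complete: "\<And>i j. u $ i * xs $ j + v $ i * ys $ j + w $ i * zs $ j = (if i = j then 1 else 0)"
begin

definition X where "X = linear_form xs"
definition Y where "Y = linear_form ys"
definition Z where "Z = linear_form zs"

lemma XYZ_in_forms: "X \<in> forms 1" "Y \<in> forms 1" "Z \<in> forms 1"
  by (simp_all only: X_def Y_def Z_def linear_form_in_forms)

lemma var_decomp: "var i = const (u $ i) * X + const (v $ i) * Y + const (w $ i) * Z"
proof -
  have "const (u $ i) * X + const (v $ i) * Y + const (w $ i) * Z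
      = (\<Sum>j\<in>UNIV. const (u $ i * xs $ j + v $ i * ys $ j + w $ i * zs $ j) * var j)"
    unfolding X_def Y_def Z_def linear_form_def sum_distrib_left sum.distrib[symmetric]
    by (intro sum.cong refl) (simp add: const_add const_mult algebra_simps)
  also have "\<dots> = (\<Sum>j\<in>UNIV. if i = j then var j else 0)"
    unfolding complete by (intro sum.cong refl) simp
  finally show ?thesis by simp
qed

lemma vec_decomp: "a = dot xs a *s u + dot ys a *s v + dot zs a *s w"
proof (rule vec_eq_iff[THEN iffD2], rule allI)
  fix i
  have "a $ i = eval (var i) a" by (simp add: eval_simps)
  also have "\<dots> = (dot xs a *s u + dot ys a *s v + dot zs a *s w) $ i"
    unfolding var_decomp X_def Y_def Z_def eval_conv_subst eval_hom.subst_add eval_hom.subst_mult eval_hom.subst_const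
    unfolding eval_conv_subst[symmetric] eval_linear_form by (simp add: mult.commute)
  finally show "a $ i = (dot xs a *s u + dot ys a *s v + dot zs a *s w) $ i" .
qed

text \<open>Inverse to \<open>X = s\<close>, \<open>Y = 1\<close> when \<open>degree p \<le> m\<close>; higher coefficients of \<open>p\<close> are dropped.\<close>

definition homog :: "nat \<Rightarrow> 'k poly \<Rightarrow> 'k form_ring"
  where "homog m p = (\<Sum>i\<le>m. const (coeff p i) * X ^ i * Y ^ (m - i))"

lemma homog_add: "homog m (p + q) = homog m p + homog m q"
  by (simp add: homog_def const_add algebra_simps sum.distrib)

lemma homog_0 [simp]: "homog m 0 = 0"
  by (simp add: homog_def)

lemma homog_smult: "homog m (smult c p) = const c * homog m p"
  unfolding homog_def sum_distrib_left coeff_smult const_mult mult.assoc ..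

lemma homog_diff: "homog m (p - q) = homog m p - homog m q"
  using homog_add[of m "p - q" q] by simp

lemma homog_in_forms: "homog m p \<in> forms m"
  unfolding homog_def
proof (rule forms_sum)
  fix i assume i: "i \<in> {..m}"
  have "X ^ i * Y ^ (m - i) \<in> forms (i + (m - i))"
    using forms_mult[OF forms_power[OF XYZ_in_forms(1)] forms_power[OF XYZ_in_forms(2)], of i "m - i"] by simp
  then show "const (coeff p i) * X ^ i * Y ^ (m - i) \<in> forms m"
    using i forms_const_mult by (simp add: mult.assoc)
qed

lemma X_mult_homog: "X * homog m p = homog (Suc m) (pCons 0 p)"
  unfolding homog_def sum_distrib_left sum.atMost_Suc_shift by (simp add: algebra_simps)

lemma Y_mult_homog:
  assumes "degree p \<le> m"
  shows "Y * homog m p = homog (Suc m) p"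
  using assms unfolding homog_def sum_distrib_left sum.atMost_Suc
  by (simp add: coeff_eq_0 Suc_diff_le algebra_simps)

lemma Y_power_mult_homog:
  assumes "degree p \<le> m"
  shows "Y ^ n * homog m p = homog (n + m) p"
proof (induction n)
  case (Suc n)
  have "Y ^ Suc n * homog m p = Y * homog (n + m) p" using Suc by (simp add: mult.assoc)
  then show ?case using Y_mult_homog[of p "n + m"] assms by simp
qed simp

lemma homog_pCons: "homog (Suc m) (pCons a p) = const a * Y ^ Suc m + X * homog m p"
  unfolding X_mult_homog unfolding homog_def sum.atMost_Suc_shift by simp

lemma homog_mult:
  assumes "degree p \<le> m" "degree q \<le> n"
  shows "homog m p * homog n q = homog (m + n) (p * q)"
  using assms(1)
proof (induction m arbitrary: p)
  case 0
  then obtain a where "p = [:a:]" using degree_eq_zeroE by blast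
  then show ?case by (simp add: homog_def[of 0] homog_smult)
next
  case (Suc m)
  obtain a p' where p: "p = pCons a p'" by (cases p)
  then have "degree p' \<le> m" using Suc.prems by (auto split: if_splits)
  then have IH: "homog m p' * homog n q = homog (m + n) (p' * q)" by (rule Suc.IH)
  have "homog (Suc m) p * homog n q = const a * (Y ^ Suc m * homog n q) + X * (homog m p' * homog n q)"
    unfolding p homog_pCons by (simp add: algebra_simps)
  also have "\<dots> = const a * homog (Suc m + n) q + homog (Suc m + n) (pCons 0 (p' * q))"
    unfolding IH X_mult_homog Y_power_mult_homog[OF assms(2)] by simp
  also have "\<dots> = homog (Suc m + n) (p * q)"
    unfolding p by (simp add: homog_smult homog_add)
  finally show ?case .
qed

text \<open>A form of degree \<open>d\<close> as a polynomial in \<open>Z\<close> whose coefficients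
  are binary forms in \<open>X\<close> and \<open>Y\<close>, stored as univariate polynomials. The
  bound \<open>D\<close> on the power of \<open>Z\<close> is kept apart from \<open>d\<close> so
  that division by \<open>F\<close> can proceed by induction on \<open>D\<close>.\<close>

definition expand :: "nat \<Rightarrow> nat \<Rightarrow> (nat \<Rightarrow> 'k poly) \<Rightarrow> 'k form_ring"
  where "expand d D p = (\<Sum>l\<le>D. homog (d - l) (p l) * Z ^ l)"

lemma form_expansion_step:
  assumes "\<forall>l\<le>d. degree (p l) \<le> d - l"
  shows "\<exists>p'. (\<forall>l\<le>Suc d. degree (p' l) \<le> Suc d - l) \<and> var i * expand d d p = expand (Suc d) (Suc d) p'"
proof -
  define pX where "pX l = (if l \<le> d then pCons 0 (p l) else 0)" for l
  define pY where "pY l = (if l \<le> d then p l else 0)" for l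
  define pZ where "pZ l = (case l of 0 \<Rightarrow> 0 | Suc l' \<Rightarrow> p l')" for l
  define p' where "p' l = smult (u $ i) (pX l) + smult (v $ i) (pY l) + smult (w $ i) (pZ l)" for l
  have X: "X * expand d d p = expand (Suc d) (Suc d) pX"
    unfolding expand_def sum_distrib_left sum.atMost_Suc
    by (simp add: pX_def mult.assoc[symmetric] X_mult_homog Suc_diff_le)
  have Y: "Y * expand d d p = expand (Suc d) (Suc d) pY"
    unfolding expand_def sum_distrib_left sum.atMost_Suc
    using assms by (simp add: pY_def mult.assoc[symmetric] Y_mult_homog Suc_diff_le)
  have Z: "Z * expand d d p = expand (Suc d) (Suc d) pZ"
    unfolding expand_def sum_distrib_left sum.atMost_Suc_shift
    by (simp add: pZ_def algebra_simps)
  have "expand (Suc d) (Suc d) p' = const (u $ i) * expand (Suc d) (Suc d) pX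
      + const (v $ i) * expand (Suc d) (Suc d) pY + const (w $ i) * expand (Suc d) (Suc d) pZ"
    unfolding expand_def p'_def sum_distrib_left sum.distrib[symmetric]
    by (intro sum.cong refl) (simp add: homog_add homog_smult mult.assoc distrib_right)
  then have "var i * expand d d p = expand (Suc d) (Suc d) p'"
    unfolding X[symmetric] Y[symmetric] Z[symmetric] var_decomp by (simp add: algebra_simps)
  moreover have "degree (p' l) \<le> Suc d - l" if "l \<le> Suc d" for l
  proof -
    have "degree (pX l) \<le> Suc d - l"
      using assms by (auto simp: pX_def Suc_diff_le)
    moreover have "degree (pY l) \<le> Suc d - l"
      using assms by (auto simp: pY_def intro: order.trans diff_le_mono)
    moreover have "degree (pZ l) \<le> Suc d - l"
      using assms that by (auto simp: pZ_def split: nat.split)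
    ultimately show ?thesis
      unfolding p'_def by (intro degree_add_le order.trans[OF degree_smult_le])
  qed
  ultimately show ?thesis by blast
qed

text \<open>Multiplication by each \<open>var i\<close>, rewritten through \<open>X\<close>,
  \<open>Y\<close>, \<open>Z\<close>, preserves such expansions, so induction on the degree reaches
  every monomial.\<close>

lemma form_expansion:
  assumes "f \<in> forms d"
  obtains p where "\<forall>l\<le>d. degree (p l) \<le> d - l" "f = expand d d p"
proof -
  define S where "S e g \<longleftrightarrow> (\<exists>p. (\<forall>l\<le>e. degree (p l) \<le> e - l) \<and> g = expand e e p)" for e g
  have add: "S d (f + g)" if fg: "S d f" "S d g" for f g
  proof -
    obtain p q where pq: "f = expand d d p" "g = expand d d q"
      "\<forall>l\<le>d. degree (p l) \<le> d - l" "\<forall>l\<le>d. degree (q l) \<le> d - l"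
      using fg unfolding S_def by blast
    have "f + g = expand d d (\<lambda>l. p l + q l)"
      unfolding pq expand_def homog_add distrib_right sum.distrib ..
    moreover have "\<forall>l\<le>d. degree (p l + q l) \<le> d - l" using pq by (auto intro: degree_add_le)
    ultimately show ?thesis unfolding S_def by (intro exI[of _ "\<lambda>l. p l + q l"] conjI)
  qed
  have scale: "S d (const c * g)" if g: "S d g" for c g
  proof -
    obtain p where p: "g = expand d d p" "\<forall>l\<le>d. degree (p l) \<le> d - l"
      using g unfolding S_def by blast
    have "const c * g = expand d d (\<lambda>l. smult c (p l))"
      unfolding p expand_def homog_smult sum_distrib_left mult.assoc ..
    moreover have "\<forall>l\<le>d. degree (smult c (p l)) \<le> d - l"
      using p by (auto intro: order.trans[OF degree_smult_le])
    ultimately show ?thesis unfolding S_def by (intro exI[of _ "\<lambda>l. smult c (p l)"] conjI)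
  qed
  have zero: "S d 0" unfolding S_def by (intro exI[of _ "\<lambda>_. 0"]) (simp add: expand_def)
  have mono: "S e (Poly_Mapping.single m 1)" if "m \<in> monomials e" for m e
    using that
  proof (induction e arbitrary: m)
    case 0
    then have "\<forall>i. Poly_Mapping.lookup m i = 0" by (auto simp: monomials_def)
    then have "m = 0" by (intro poly_mapping_eqI) simp
    then have "Poly_Mapping.single m 1 = expand 0 0 (\<lambda>_. 1)" by (simp add: expand_def homog_def)
    then show ?case unfolding S_def by (intro exI[of _ "\<lambda>_. 1"]) simp
  next
    case (Suc e)
    then obtain i where i: "Poly_Mapping.lookup m i \<noteq> 0"
      unfolding monomials_def by fastforce
    let ?n = "m - Poly_Mapping.single i 1"
    have m: "m = Poly_Mapping.single i 1 + ?n"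
      using i by (intro poly_mapping_eqI) (auto simp: lookup_add lookup_minus lookup_single when_def)
    have "(\<Sum>j\<in>UNIV. Poly_Mapping.lookup (Poly_Mapping.single i 1) j) = (1 :: nat)"
      by (simp add: lookup_single when_def)
    moreover have "(\<Sum>j\<in>UNIV. Poly_Mapping.lookup (Poly_Mapping.single i 1 + ?n) j) = Suc e"
      using Suc.prems m by (simp add: monomials_def)
    ultimately have "?n \<in> monomials e"
      unfolding monomials_def lookup_add sum.distrib by simp
    then obtain p where p: "Poly_Mapping.single ?n 1 = expand e e p" "\<forall>l\<le>e. degree (p l) \<le> e - l"
      using Suc.IH[of ?n] unfolding S_def by blast
    have "Poly_Mapping.single m (1 :: 'k) = var i * Poly_Mapping.single ?n 1"
      unfolding var_def mult_single m[symmetric] by simp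
    then show ?case using form_expansion_step[OF p(2), of i] p(1) unfolding S_def by simp
  qed
  have "S d (\<Sum>m\<in>A. Poly_Mapping.single m (Poly_Mapping.lookup f m))" if "A \<subseteq> Poly_Mapping.keys f" for A
    using finite_subset[OF that finite_keys] that
  proof (induction A rule: finite_induct)
    case empty
    show ?case using zero by simp
  next
    case (insert m A)
    have "S d (Poly_Mapping.single m (1 :: 'k))"
      using insert.prems assms by (intro mono) (auto simp: forms_def monomials_def)
    then have "S d (const (Poly_Mapping.lookup f m) * Poly_Mapping.single m 1)" by (rule scale)
    then have "S d (Poly_Mapping.single m (Poly_Mapping.lookup f m))"
      by (simp add: const_def mult_single)
    then show ?case using add insert by simp
  qed
  from this[OF order_refl] have "S d f" unfolding sum_single_decomp .
  then show thesis using that unfolding S_def by blast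
qed

end

section \<open>The square of a point ideal\<close>

lemma coord_ring_ideal_sum:
  assumes "ideal I (coord_ring :: 'k::field form_ring ring)" "\<And>i. i \<in> A \<Longrightarrow> f i \<in> I"
  shows "(\<Sum>i\<in>A. f i) \<in> I"
  using assms(2)
  by (induction A rule: infinite_finite_induct) (simp_all add: coord_ring_idealD[OF assms(1)])

lemma ideal_prod_mult_mem:
  "f \<in> I \<Longrightarrow> g \<in> J \<Longrightarrow> f * g \<in> ideal_prod (coord_ring :: 'k::field form_ring ring) I J"
  using ideal_prod.prod[of f I g J coord_ring] by simp

lemma power_minus_two: "2 \<le> i \<Longrightarrow> x ^ i = x ^ (i - 2) * (x * x)" for x :: "'a::monoid_mult"
  by (metis le_add_diff_inverse2 power2_eq_square power_add)

context plane_coords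
begin

abbreviation line_psubst :: "'k ^ 3 \<Rightarrow> 'k ^ 3 \<Rightarrow> 'k form_ring \<Rightarrow> 'k poly"
  where "line_psubst a b \<equiv> psubst (\<lambda>i. [:a $ i, b $ i:])"

lemma psubst_homog: "psubst y (homog m p) = (\<Sum>i\<le>m. [:coeff p i:] * psubst y X ^ i * psubst y Y ^ (m - i))"
  unfolding homog_def psubst_simps ..

lemma psubst_expand: "psubst y (expand d D p) = (\<Sum>l\<le>D. psubst y (homog (d - l) (p l)) * psubst y Z ^ l)"
  unfolding expand_def psubst_simps ..

lemma psubst_homog_X_0:
  assumes "psubst y X = 0" "psubst y Y = [:0, 1:]"
  shows "psubst y (homog m p) = monom (coeff p 0) m"
proof -
  have "psubst y (homog m p) = (\<Sum>i\<le>m. if i = 0 then [:coeff p 0:] * [:0, 1:] ^ m else 0)"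
    unfolding psubst_homog assms by (intro sum.cong refl) (auto simp: zero_power)
  then show ?thesis by (simp add: monom_altdef)
qed

lemma psubst_homog_Y_0:
  assumes "psubst y X = [:0, 1:]" "psubst y Y = 0"
  shows "psubst y (homog m p) = monom (coeff p m) m"
proof -
  have "psubst y (homog m p) = (\<Sum>i\<le>m. if i = m then [:coeff p m:] * [:0, 1:] ^ m else 0)"
    unfolding psubst_homog assms by (intro sum.cong refl) (auto simp: zero_power)
  then show ?thesis by (simp add: monom_altdef)
qed

lemma line_psubst_u: "line_psubst w u X = [:0, 1:]" "line_psubst w u Y = 0" "line_psubst w u Z = 1"
  and line_psubst_v: "line_psubst w v X = 0" "line_psubst w v Y = [:0, 1:]" "line_psubst w v Z = 1"
  unfolding X_def Y_def Z_def psubst_line_linear_form dual by (simp_all add: one_pCons)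

lemma coeff_sum_monom_diff:
  assumes "n \<le> (d :: nat)"
  shows "coeff (\<Sum>l\<le>d. monom (c l) (d - l)) n = (c (d - n) :: 'k)"
proof -
  have "coeff (\<Sum>l\<le>d. monom (c l) (d - l)) n = (\<Sum>l\<le>d. if l = d - n then c l else 0)"
    unfolding coeff_sum using assms by (intro sum.cong refl) auto
  then show ?thesis by simp
qed

text \<open>On the line from \<open>w\<close> in direction \<open>u\<close> one has
  \<open>Y = 0\<close>, \<open>Z = 1\<close> and \<open>X\<close> as parameter, so only the
  monomials \<open>X ^ n * Z ^ (d - n)\<close> survive; in direction \<open>v\<close> the roles of
  \<open>X\<close> and \<open>Y\<close> are exchanged.\<close>

lemma coeff_line_psubst_expand:
  assumes "n \<le> d"
  shows "coeff (line_psubst w u (expand d d p)) n = coeff (p (d - n)) n"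
    and "coeff (line_psubst w v (expand d d p)) n = coeff (p (d - n)) 0"
proof -
  have "line_psubst w u (expand d d p) = (\<Sum>l\<le>d. monom (coeff (p l) (d - l)) (d - l))"
    unfolding psubst_expand line_psubst_u(3) psubst_homog_Y_0[OF line_psubst_u(1,2)] by simp
  then show "coeff (line_psubst w u (expand d d p)) n = coeff (p (d - n)) n"
    using coeff_sum_monom_diff[OF assms, of "\<lambda>l. coeff (p l) (d - l)"] assms by simp
  have "line_psubst w v (expand d d p) = (\<Sum>l\<le>d. monom (coeff (p l) 0) (d - l))"
    unfolding psubst_expand line_psubst_v(3) psubst_homog_X_0[OF line_psubst_v(1,2)] by simp
  then show "coeff (line_psubst w v (expand d d p)) n = coeff (p (d - n)) 0"
    using coeff_sum_monom_diff[OF assms, of "\<lambda>l. coeff (p l) 0"] by simp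
qed

abbreviation "I_w \<equiv> point_ideal (vec.span {w})"
abbreviation "I2_w \<equiv> ideal_prod coord_ring I_w I_w"

lemma XY_in_point_ideal: "X \<in> I_w" "Y \<in> I_w"
  using point_ideal_span_memI[OF XYZ_in_forms(1)] point_ideal_span_memI[OF XYZ_in_forms(2)]
  by (simp_all add: X_def Y_def eval_linear_form dual)

text \<open>Each monomial of degree at least 2 in \<open>X\<close> and \<open>Y\<close> contains
  \<open>X * X\<close>, \<open>X * Y\<close> or \<open>Y * Y\<close>, and both variables lie in
  \<open>I_w\<close>.\<close>

lemma homog_in_square_ideal:
  assumes "2 \<le> m"
  shows "homog m p \<in> I2_w"
  unfolding homog_def
proof (rule coord_ring_ideal_sum[OF square_ideal_is_ideal])
  note sq = coord_ring_idealD(3)[OF square_ideal_is_ideal]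
  fix i assume i: "i \<in> {..m}"
  consider "2 \<le> i" | "i = 1" | "i = 0" by linarith
  then show "const (coeff p i) * X ^ i * Y ^ (m - i) \<in> I2_w"
  proof cases
    case 1
    have "const (coeff p i) * X ^ i * Y ^ (m - i) = (const (coeff p i) * X ^ (i - 2) * Y ^ (m - i)) * (X * X)"
      unfolding power_minus_two[OF 1] by (simp only: ac_simps)
    then show ?thesis using sq[OF ideal_prod_mult_mem[OF XY_in_point_ideal(1,1)]] by (simp only:)
  next
    case 2
    obtain n where m: "m = Suc (Suc n)" using assms by (metis add_2_eq_Suc le_Suc_ex)
    have "const (coeff p i) * X ^ i * Y ^ (m - i) = (const (coeff p i) * Y ^ n) * (X * Y)"
      unfolding 2 m diff_Suc_1 power_Suc power_one_right by (simp only: ac_simps)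
    then show ?thesis using sq[OF ideal_prod_mult_mem[OF XY_in_point_ideal(1,2)]] by (simp only:)
  next
    case 3
    have "const (coeff p i) * X ^ i * Y ^ (m - i) = (const (coeff p i) * Y ^ (m - 2)) * (Y * Y)"
      unfolding 3 minus_nat.diff_0 power_minus_two[OF assms] power_0 mult_1_right by (simp only: ac_simps)
    then show ?thesis using sq[OF ideal_prod_mult_mem[OF XY_in_point_ideal(2,2)]] by (simp only:)
  qed
qed

text \<open>Only \<open>Z ^ d\<close>, \<open>X * Z ^ (d - 1)\<close> and
  \<open>Y * Z ^ (d - 1)\<close> have fewer than two factors among \<open>X\<close> and
  \<open>Y\<close>. Their coefficients are the value at \<open>w\<close> and the linear coefficients
  along the two lines.\<close>

lemma singular_form_expansion:
  assumes f: "f \<in> forms d" "eval f w = 0"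
    and deriv: "coeff (line_psubst w u f) 1 = 0" "coeff (line_psubst w v f) 1 = 0"
  obtains p where "\<forall>l\<le>d. degree (p l) \<le> d - l" "f = expand d d p"
    "\<And>l. l \<le> d \<Longrightarrow> d < l + 2 \<Longrightarrow> homog (d - l) (p l) = 0"
proof -
  obtain p where p: "\<forall>l\<le>d. degree (p l) \<le> d - l" "f = expand d d p"
    using form_expansion[OF f(1)] .
  have "homog (d - l) (p l) = 0" if l: "l \<le> d" "d < l + 2" for l
  proof (cases "l = d")
    case True
    have "coeff (p d) 0 = 0"
      using coeff_line_psubst_expand(1)[of 0 d p] f(2) coeff_psubst_line_0[of w u f] by (simp add: p(2))
    then show ?thesis by (simp add: True homog_def)
  next
    case False
    then have d: "d = Suc l" using l by simp
    have "coeff (p l) 1 = 0" "coeff (p l) 0 = 0"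
      using coeff_line_psubst_expand[of 1 d p] deriv d by (simp_all add: p(2))
    then show ?thesis by (simp add: d homog_def)
  qed
  then show thesis using that p by blast
qed

lemma form_in_square_ideal:
  assumes "f \<in> forms d" "eval f w = 0"
    and "coeff (line_psubst w u f) 1 = 0" "coeff (line_psubst w v f) 1 = 0"
  shows "f \<in> I2_w"
proof -
  obtain p where p: "f = expand d d p" "\<And>l. l \<le> d \<Longrightarrow> d < l + 2 \<Longrightarrow> homog (d - l) (p l) = 0"
    using singular_form_expansion[OF assms] by metis
  note I = coord_ring_idealD[OF square_ideal_is_ideal]
  show ?thesis unfolding p(1) expand_def
  proof (rule coord_ring_ideal_sum[OF square_ideal_is_ideal])
    fix l assume l: "l \<in> {..d}"
    have "homog (d - l) (p l) \<in> I2_w"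
    proof (cases "d < l + 2")
      case True
      then show ?thesis using p(2)[of l] l I(1) by simp
    next
      case False
      then show ?thesis by (intro homog_in_square_ideal) simp
    qed
    then show "homog (d - l) (p l) * Z ^ l \<in> I2_w"
      unfolding mult.commute[of _ "Z ^ l"] by (rule I(3))
  qed
qed

end

lemma exists_plane_coords:
  fixes w :: "'k::field ^ 3"
  assumes "w \<noteq> 0"
  obtains u v xs ys zs where "plane_coords u v w xs ys zs"
proof -
  consider "w $ 1 \<noteq> 0" | "w $ 2 \<noteq> 0" | "w $ 3 \<noteq> 0"
    using assms by (auto simp: vec_eq_iff forall_3)
  then show thesis
  proof cases
    case 1
    have "plane_coords (vector [0, 1, 0]) (vector [0, 0, 1]) w
      (vector [- w $ 2 / w $ 1, 1, 0]) (vector [- w $ 3 / w $ 1, 0, 1]) (vector [1 / w $ 1, 0, 0])"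
      unfolding plane_coords_def dot_def sum_3 forall_3 using 1 by simp
    then show thesis by (rule that)
  next
    case 2
    have "plane_coords (vector [1, 0, 0]) (vector [0, 0, 1]) w
      (vector [1, - w $ 1 / w $ 2, 0]) (vector [0, - w $ 3 / w $ 2, 1]) (vector [0, 1 / w $ 2, 0])"
      unfolding plane_coords_def dot_def sum_3 forall_3 using 2 by simp
    then show thesis by (rule that)
  next
    case 3
    have "plane_coords (vector [1, 0, 0]) (vector [0, 1, 0]) w
      (vector [1, 0, - w $ 1 / w $ 3]) (vector [0, 1, - w $ 2 / w $ 3]) (vector [0, 0, 1 / w $ 3])"
      unfolding plane_coords_def dot_def sum_3 forall_3 using 3 by simp
    then show thesis by (rule that)
  qed
qed

section \<open>Conditions imposed by double points\<close>

lemma double_point_ideal_is_ideal: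
  "ideal (double_point_ideal T) (coord_ring :: 'k::field form_ring ring)"
  unfolding double_point_ideal_def
  by (rule coord_ring_idealI) (blast intro: coord_ring_idealD(1-3)[OF square_ideal_is_ideal])+

text \<open>Being double at a point amounts to a value and two directional derivatives, taken in
  coordinates chosen separately for each point; \<open>g\<close> lists these three
  functionals.\<close>

lemma dim_forms_le_double_point_ideal:
  fixes T :: "('k::field ^ 3) set set"
  assumes T: "finite T" "T \<subseteq> proj_plane"
  shows "form_space.dim (forms d :: 'k form_ring set)
    \<le> form_space.dim (double_point_ideal T \<inter> forms d) + 3 * card T"
proof -
  have "\<exists>u v w xs ys zs. plane_coords u v w xs ys zs \<and> p = vec.span {w}" if p: "p \<in> T" for p
  proof -
    obtain w where "p = vec.span {w}" "w \<noteq> 0" using p T(2) by (auto simp: proj_plane_def)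
    then show ?thesis using exists_plane_coords[of w] by metis
  qed
  then obtain u v w xs ys zs where c: "\<And>p. p \<in> T \<Longrightarrow> plane_coords (u p) (v p) (w p) (xs p) (ys p) (zs p)"
      "\<And>p. p \<in> T \<Longrightarrow> p = vec.span {w p}"
    by metis
  define g where "g = (\<lambda>(p, j :: nat) f. if j = 0 then eval f (w p)
    else if j = 1 then coeff (psubst (\<lambda>i. [:w p $ i, u p $ i:]) f) 1
    else coeff (psubst (\<lambda>i. [:w p $ i, v p $ i:]) f) 1)"
  obtain B where B: "finite B" "(forms d :: 'k form_ring set) \<subseteq> form_space.span B"
    using forms_fin_spanned .
  have "form_space.dim (forms d :: 'k form_ring set)
      \<le> form_space.dim (double_point_ideal T \<inter> forms d) + card (T \<times> {..<3::nat})"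
  proof (rule form_space.dim_le_functionals[where f = g])
    show "finite (T \<times> {..<3::nat})" using T(1) by simp
    show "{f \<in> forms d. \<forall>i\<in>T \<times> {..<3}. g i f = 0} \<subseteq> double_point_ideal T \<inter> forms d"
    proof safe
      fix f assume f: "f \<in> forms d" and *: "\<forall>i\<in>T \<times> {..<3}. g i f = 0"
      have "f \<in> ideal_prod coord_ring (point_ideal p) (point_ideal p)" if p: "p \<in> T" for p
      proof -
        interpret plane_coords "u p" "v p" "w p" "xs p" "ys p" "zs p" by (rule c(1)[OF p])
        have "g (p, 0) f = 0" "g (p, 1) f = 0" "g (p, 2) f = 0" using * p by auto
        then have "f \<in> I2_w" using f by (intro form_in_square_ideal) (simp_all add: g_def)
        then show ?thesis using c(2)[OF p] by simp
      qed
      then show "f \<in> double_point_ideal T" by (simp add: double_point_ideal_def)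
    qed
    show "double_point_ideal T \<inter> forms d \<subseteq> form_space.span B" using B(2) by blast
    fix i x y c
    show "g i (x + y) = g i x + g i y"
      by (auto simp: g_def eval_simps psubst_simps split: prod.split)
    show "g i (const c * x) = c * g i x"
      by (auto simp: g_def eval_simps psubst_simps split: prod.split)
  qed (use B subspace_forms in auto)
  then show ?thesis by (simp add: card_cartesian_product mult.commute)
qed

section \<open>Parametrization of a singular cubic\<close>

text \<open>Without a common root \<open>m\<close> and \<open>k\<close> are coprime over an
  algebraically closed field. The linear factors of \<open>m\<close> are cancelled one at a
  time.\<close>

lemma dvd_mult_cancel_no_common_root:
  fixes m k p :: "'k::alg_closed_field poly"
  assumes "m \<noteq> 0" "\<And>s. poly m s = 0 \<Longrightarrow> poly k s \<noteq> 0" "m dvd k * p"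
  shows "m dvd p"
  using assms
proof (induction "degree m" arbitrary: m p)
  case 0
  then show ?case by (metis is_unit_iff_degree unit_imp_dvd)
next
  case (Suc n)
  then obtain r where r: "poly m r = 0" using alg_closed_imp_poly_has_root[of m] by auto
  then obtain m' where m': "m = [:-r, 1:] * m'" by (auto simp: poly_eq_0_iff_dvd)
  have "poly (k * p) r = 0" using Suc.prems(3) r by (metis dvd_trans poly_eq_0_iff_dvd)
  then have "poly p r = 0" using Suc.prems(2)[OF r] by simp
  then obtain p' where p': "p = [:-r, 1:] * p'" by (auto simp: poly_eq_0_iff_dvd)
  have m0: "m' \<noteq> 0" using Suc.prems(1) m' by auto
  have "degree m = Suc (degree m')" unfolding m' using m0 by (subst degree_mult_eq) auto
  then have "n = degree m'" using Suc.hyps(2) by simp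
  moreover have "m' dvd k * p'"
  proof -
    have "[:-r, 1:] * m' dvd [:-r, 1:] * (k * p')"
      using Suc.prems(3) unfolding m' p' by (simp only: mult.left_commute)
    then show ?thesis by (metis dvd_mult_cancel_left pCons_eq_0_iff zero_neq_one)
  qed
  ultimately have "m' dvd p'" using Suc.hyps(1)[of m' p'] m0 Suc.prems(2) m' by auto
  then show ?case unfolding m' p' by (rule mult_dvd_mono[OF dvd_refl])
qed

text \<open>The factors have no roots in common, so their divisibilities combine into that of the
  product.\<close>

lemma mult_prod_linear_dvd:
  fixes q g :: "'k::alg_closed_field poly"
  assumes "finite S" "q dvd g" "q \<noteq> 0" "\<And>s. s \<in> S \<Longrightarrow> poly q s \<noteq> 0"
    "\<And>s. s \<in> S \<Longrightarrow> [:-s, 1:] ^ j dvd g"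
  shows "q * (\<Prod>s\<in>S. [:-s, 1:] ^ j) dvd g"
  using assms
proof (induction S rule: finite_induct)
  case (insert s S)
  let ?m = "q * (\<Prod>s\<in>S. [:-s, 1:] ^ j)"
  have "?m dvd g" using insert by simp
  then obtain h where h: "g = ?m * h" by blast
  have "[:-s, 1:] ^ j dvd h"
  proof (rule dvd_mult_cancel_no_common_root)
    show "[:-s, 1:] ^ j dvd ?m * h" using insert.prems(4)[of s] h by simp
    fix x assume "poly ([:-s, 1:] ^ j) x = 0"
    then have "x = s" by (simp add: poly_power)
    then show "poly ?m x \<noteq> 0"
      using insert.prems(3)[of s] insert.hyps by (auto simp: poly_prod poly_power)
  qed simp
  then have "?m * [:-s, 1:] ^ j dvd g" unfolding h by (rule mult_dvd_mono[OF dvd_refl])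
  then show ?case using insert.hyps by (simp add: ac_simps)
qed simp

lemma degree_mult_prod_linear:
  fixes q :: "'k::field poly"
  assumes "finite S" "q \<noteq> 0"
  shows "degree (q * (\<Prod>s\<in>S. [:-s, 1:] ^ j)) = degree q + j * card S"
proof -
  have "degree (\<Prod>s\<in>S. [:-s, 1:] ^ j) = (\<Sum>s\<in>S. degree ([:-s, 1:] ^ j))"
    by (rule degree_prod_eq_sum_degree) simp
  also have "\<dots> = j * card S" by (simp add: degree_linear_power)
  finally show ?thesis using assms by (subst degree_mult_eq) auto
qed

text \<open>The roots of \<open>q\<close> are the tangent directions at the singular point \<open>w\<close>; \<open>degree q = 2\<close> says that
  the line \<open>Y = 0\<close> is not a tangent, so that no root escapes to infinity.\<close>

locale nodal_cuspidal_cubic = plane_coords u v w xs ys zs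
  for u v w :: "'k::alg_closed_field ^ 3" and xs ys zs +
  fixes F q k
  assumes F_eq: "F = homog 2 q * Z + homog 3 k"
    and degree_q: "degree q = 2" and degree_k: "degree k \<le> 3"
    and no_common_root: "\<And>s. poly q s = 0 \<Longrightarrow> poly k s \<noteq> 0"
begin

lemma q_neq_0: "q \<noteq> 0"
  using degree_q by auto

text \<open>The line joining \<open>w\<close> to \<open>s u + v\<close> meets the cubic twice at
  \<open>w\<close> and once more where \<open>Z = - k / q\<close>; multiplying by \<open>q\<close>
  clears the denominator. At a root of \<open>q\<close> the residual point is \<open>w\<close>
  itself.\<close>

definition \<psi> :: "3 \<Rightarrow> 'k poly"
  where "\<psi> i = q * [:v $ i, u $ i:] - k * [:w $ i:]"

abbreviation \<phi> :: "'k form_ring \<Rightarrow> 'k poly"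
  where "\<phi> \<equiv> psubst \<psi>"

lemma \<phi>_linear_form: "\<phi> (linear_form a) = q * [:dot a v, dot a u:] - k * [:dot a w:]"
  unfolding psubst_linear_form \<psi>_def dot_def sum_3 by (simp add: algebra_simps smult_add_left)

lemma \<phi>_XYZ: "\<phi> X = q * [:0, 1:]" "\<phi> Y = q" "\<phi> Z = - k"
  unfolding X_def Y_def Z_def \<phi>_linear_form dual by simp_all

lemma \<phi>_homog:
  assumes "degree p \<le> m"
  shows "\<phi> (homog m p) = q ^ m * p"
proof -
  have "\<phi> (homog m p) = (\<Sum>i\<le>m. q ^ m * monom (coeff p i) i)"
    unfolding psubst_homog \<phi>_XYZ
  proof (intro sum.cong refl)
    fix i assume "i \<in> {..m}"
    then have m: "q ^ m = q ^ i * q ^ (m - i)" by (simp flip: power_add)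
    have "monom (coeff p i) i = [:coeff p i:] * [:0, 1:] ^ i" by (simp add: monom_altdef)
    then show "[:coeff p i:] * (q * [:0, 1:]) ^ i * q ^ (m - i) = q ^ m * monom (coeff p i) i"
      unfolding m power_mult_distrib by (simp only: ac_simps)
  qed
  also have "\<dots> = q ^ m * p"
    using poly_as_sum_of_monoms'[OF assms] by (simp flip: sum_distrib_left)
  finally show ?thesis .
qed

lemma \<phi>_F: "\<phi> F = 0"
  unfolding F_eq psubst_simps \<phi>_XYZ
  using \<phi>_homog[of q 2] \<phi>_homog[OF degree_k] degree_q
  by (simp add: power2_eq_square power3_eq_cube algebra_simps)

lemma degree_\<phi>: "f \<in> forms d \<Longrightarrow> degree (\<phi> f) \<le> 3 * d"
proof -
  have "degree (\<psi> i) \<le> 3" for i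
    unfolding \<psi>_def using degree_q degree_k
    by (intro degree_diff_le order.trans[OF degree_mult_le]) auto
  then show "f \<in> forms d \<Longrightarrow> degree (\<phi> f) \<le> 3 * d"
    using degree_psubst_le[of f d \<psi> 3] by (simp add: mult.commute)
qed

lemma F_in_forms: "F \<in> forms 3"
  using forms_mult[OF homog_in_forms[of 2 q] XYZ_in_forms(3)] homog_in_forms[of 3 k]
  unfolding F_eq by (simp add: forms_add)

text \<open>The coefficient of \<open>X ^ 2 * Z\<close> in \<open>F\<close> is the leading
  coefficient of \<open>q\<close>.\<close>

lemma F_neq_0: "F \<noteq> 0"
proof
  assume "F = 0"
  have "line_psubst w u (expand 3 3 (\<lambda>l. if l = 0 then k else if l = 1 then q else 0)) = 0"
    using \<open>F = 0\<close> F_eq by (simp add: expand_def numeral_3_eq_3 numeral_2_eq_2 psubst.subst_0 add.commute)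
  then have "coeff q 2 = 0"
    using coeff_line_psubst_expand(1)[of 2 3 "\<lambda>l. if l = 0 then k else if l = 1 then q else 0"] by simp
  then show False using degree_q q_neq_0 by (metis leading_coeff_0_iff)
qed

text \<open>If \<open>\<phi>\<close> kills a form of \<open>Z\<close>-degree \<open>D + 1\<close>, then \<open>q\<close> divides its leading coefficient, and a multiple
  of \<open>F\<close> with quotient of \<open>Z\<close>-degree \<open>D\<close> removes the leading term.\<close>

lemma expand_in_F_multiples:
  assumes "\<forall>l\<le>D. degree (p l) \<le> d - l" "D \<le> d" "\<phi> (expand d D p) = 0"
  shows "\<exists>H. H \<in> forms (d - 3) \<and> (d < 3 \<longrightarrow> H = 0) \<and> expand d D p = F * H"
  using assms
proof (induction D arbitrary: p)
  case 0
  have "q ^ d * p 0 = 0" using 0 \<phi>_homog[of "p 0" d] by (simp add: expand_def)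
  then have "p 0 = 0" using q_neq_0 by simp
  then show ?case by (intro exI[of _ 0]) (simp add: expand_def)
next
  case (Suc D)
  let ?m = "d - Suc D"
  have \<phi>_term: "\<phi> (homog (d - l) (p l) * Z ^ l) = q ^ (d - l) * p l * (- k) ^ l" if "l \<le> Suc D" for l
    unfolding psubst_simps \<phi>_XYZ using \<phi>_homog[of "p l" "d - l"] Suc.prems(1) that by simp
  \<comment> \<open>Every term with \<open>l \<le> D\<close> carries at least one power of
    \<open>q\<close> more than the leading term. After division by \<open>q ^ ?m\<close> only the
    leading term is left modulo \<open>q\<close>.\<close>
  define A where "A = (\<Sum>l\<le>D. q ^ (D - l) * p l * (- k) ^ l)"
  have "\<phi> (expand d (Suc D) p) = q ^ ?m * (q * A + (- k) ^ Suc D * p (Suc D))"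
  proof -
    have "\<phi> (expand d (Suc D) p) = (\<Sum>l\<le>D. q ^ (d - l) * p l * (- k) ^ l) + q ^ ?m * p (Suc D) * (- k) ^ Suc D"
      unfolding expand_def sum.atMost_Suc psubst.subst_add psubst.subst_sum
      by (intro arg_cong2[of _ _ _ _ "(+)"] sum.cong refl \<phi>_term) auto
    also have "(\<Sum>l\<le>D. q ^ (d - l) * p l * (- k) ^ l) = (\<Sum>l\<le>D. q ^ ?m * (q * (q ^ (D - l) * p l * (- k) ^ l)))"
    proof (intro sum.cong refl)
      fix l assume "l \<in> {..D}"
      then have "d - l = ?m + Suc (D - l)" using Suc.prems(2) by simp
      then have "q ^ (d - l) = q ^ ?m * (q * q ^ (D - l))" by (simp only: power_add power_Suc)
      then show "q ^ (d - l) * p l * (- k) ^ l = q ^ ?m * (q * (q ^ (D - l) * p l * (- k) ^ l))"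
        by (simp only: mult.assoc)
    qed
    finally show ?thesis unfolding A_def by (simp add: sum_distrib_left algebra_simps)
  qed
  then have "q * A + (- k) ^ Suc D * p (Suc D) = 0" using Suc.prems(3) q_neq_0 by simp
  then have "(- k) ^ Suc D * p (Suc D) = q * (- A)"
    by (simp add: add_eq_0_iff del: power_Suc)
  then have "q dvd (- k) ^ Suc D * p (Suc D)" unfolding dvd_def by blast
  moreover have "poly ((- k) ^ Suc D) s \<noteq> 0" if "poly q s = 0" for s
    using no_common_root[OF that] unfolding poly_power by simp
  ultimately have "q dvd p (Suc D)" using dvd_mult_cancel_no_common_root[OF q_neq_0] by blast
  then obtain r where r: "p (Suc D) = q * r" by blast
  show ?case
  proof (cases "r = 0")
    case True
    then have "expand d (Suc D) p = expand d D p" by (simp add: expand_def r)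
    then show ?thesis using Suc.IH[of p] Suc.prems by simp
  next
    case False
    then have "degree (p (Suc D)) = 2 + degree r" unfolding r using q_neq_0 by (simp add: degree_mult_eq degree_q)
    then have deg: "2 + degree r \<le> ?m" using Suc.prems(1) by fastforce
    define e where "e = ?m - 2"
    have e: "d = Suc D + (2 + e)" "degree r \<le> e" using deg by (simp_all add: e_def)
    \<comment> \<open>Subtracting \<open>F * H0\<close> removes the term in
      \<open>Z ^ Suc D\<close>; the part \<open>homog 3 k\<close> of \<open>F\<close> changes the
      next coefficient by \<open>k * r\<close>.\<close>
    define p' where "p' = p(D := p D - k * r)"
    define H0 where "H0 = homog e r * Z ^ D"
    have FH0: "F * H0 = homog (2 + e) (q * r) * Z ^ Suc D + homog (3 + e) (k * r) * Z ^ D"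
    proof -
      have "F * H0 = (homog 2 q * homog e r) * Z ^ Suc D + (homog 3 k * homog e r) * Z ^ D"
        unfolding F_eq H0_def power_Suc by (simp only: distrib_right distrib_left ac_simps)
      then show ?thesis using homog_mult[of q 2 r e] homog_mult[OF degree_k e(2)] degree_q e(2) by simp
    qed
    have ex: "expand d (Suc D) p = F * H0 + expand d D p'"
    proof -
      have "expand d D p' = expand d D p - homog (d - D) (k * r) * Z ^ D"
      proof (cases D)
        case 0
        then show ?thesis by (simp add: expand_def p'_def homog_diff algebra_simps)
      next
        case (Suc D')
        have "(\<Sum>l\<le>D'. homog (d - l) (p' l) * Z ^ l) = (\<Sum>l\<le>D'. homog (d - l) (p l) * Z ^ l)"
          by (intro sum.cong refl) (simp add: p'_def Suc)
        moreover have "p' (Suc D') = p (Suc D') - k * r" by (simp add: p'_def Suc)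
        ultimately show ?thesis unfolding expand_def Suc sum.atMost_Suc
          by (simp only: homog_diff left_diff_distrib add_diff_eq)
      qed
      moreover have "d - D = 3 + e" "d - Suc D = 2 + e" using e(1) by simp_all
      moreover have "expand d (Suc D) p = expand d D p + homog (d - Suc D) (q * r) * Z ^ Suc D"
        unfolding expand_def sum.atMost_Suc r ..
      ultimately show ?thesis unfolding FH0 by simp
    qed
    have "\<phi> (expand d D p') = 0"
      using Suc.prems(3) unfolding ex psubst_simps \<phi>_F by simp
    moreover have "\<forall>l\<le>D. degree (p' l) \<le> d - l"
    proof (intro allI impI)
      fix l assume l: "l \<le> D"
      have "degree (k * r) \<le> d - D"
        using order.trans[OF degree_mult_le, of k r] degree_k e by simp
      then show "degree (p' l) \<le> d - l"
        using Suc.prems(1) l by (auto simp: p'_def intro: degree_diff_le)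
    qed
    ultimately obtain H1 where H1: "H1 \<in> forms (d - 3)" "expand d D p' = F * H1"
      using Suc.IH[of p'] Suc.prems(2) by auto
    have "H0 \<in> forms (d - 3)"
      using forms_mult[OF homog_in_forms forms_power[OF XYZ_in_forms(3)], of e r D] e(1)
      by (simp add: H0_def add.commute)
    then have "H0 + H1 \<in> forms (d - 3)" using H1(1) by (rule forms_add)
    moreover have "expand d (Suc D) p = F * (H0 + H1)" unfolding ex H1(2) by (simp only: distrib_left)
    ultimately show ?thesis using e(1) by auto
  qed
qed

text \<open>The forms vanishing on the curve are the multiples of \<open>F\<close>. For
  \<open>d < 3\<close> the subtraction in \<open>forms (d - 3)\<close> truncates to 0, so the second
  clause is there to exclude nonzero constants.\<close>

lemma \<phi>_kernel:
  assumes "f \<in> forms d" "\<phi> f = 0"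
  obtains H where "H \<in> forms (d - 3)" "d < 3 \<Longrightarrow> H = 0" "f = F * H"
proof -
  obtain p where p: "\<forall>l\<le>d. degree (p l) \<le> d - l" "f = expand d d p"
    using form_expansion[OF assms(1)] .
  show thesis using expand_in_F_multiples[OF p(1) order_refl] assms(2) p(2) that by blast
qed

end

section \<open>Dimension bounds\<close>

lemma form_space_dim_zero: "form_space.dim ({0} :: 'k::field form_ring set) = 0"
proof (rule form_space.dim_unique)
  show "{0} \<subseteq> form_space.span {}" unfolding form_space.span_empty ..
qed (simp_all only: form_space.independent_empty empty_subsetI card.empty not_False_eq_True)

context nodal_cuspidal_cubic
begin

text \<open>Bezout's theorem for the cubic: the coefficients of \<open>\<phi> f div m\<close> are functionals on \<open>U\<close> whose common
  kernel consists of multiples of \<open>F\<close>.\<close>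

lemma dim_le_of_\<phi>_dvd:
  assumes U: "form_space.subspace U" "U \<subseteq> forms d"
    and V: "form_space.subspace V" "\<And>H. H \<in> forms (d - 3) \<Longrightarrow> F * H \<in> U \<Longrightarrow> H \<in> V"
      "V \<subseteq> forms (d - 3)"
    and m: "m \<noteq> 0" "\<And>f. f \<in> U \<Longrightarrow> m dvd \<phi> f"
  shows "form_space.dim U \<le> (if d < 3 then 0 else form_space.dim V) + (3 * d + 1 - degree m)"
proof -
  \<comment> \<open>The number of coefficients of a polynomial of degree at most \<open>3 d\<close>
    after division by \<open>m\<close>; truncation to 0 covers the case that \<open>m\<close> has
    larger degree and forces \<open>\<phi> f = 0\<close>.\<close>
  let ?N = "3 * d + 1 - degree m"
  let ?V = "if d < 3 then {0} else V"
  obtain B where B: "finite B" "(forms d :: 'k form_ring set) \<subseteq> form_space.span B"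
    using forms_fin_spanned .
  obtain B' where B': "finite B'" "(forms d :: 'k form_ring set) \<subseteq> form_space.span B'"
    using forms_fin_spanned .
  have "form_space.dim U \<le> form_space.dim ((*) F ` ?V) + card {..<?N}"
  proof (rule form_space.dim_le_functionals[where f = "\<lambda>i f. coeff (\<phi> f div m) i"])
    show "finite {..<?N}" by simp
    show "U \<subseteq> form_space.span B" using U(2) B(2) by blast
    show "{f \<in> U. \<forall>i\<in>{..<?N}. coeff (\<phi> f div m) i = 0} \<subseteq> (*) F ` ?V"
    proof safe
      fix f assume f: "f \<in> U" and z: "\<forall>i\<in>{..<?N}. coeff (\<phi> f div m) i = 0"
      obtain h where h: "\<phi> f = m * h" using m(2)[OF f] by blast
      have "h = 0"
      proof (rule ccontr)
        assume "h \<noteq> 0"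
        then have "degree (\<phi> f) = degree m + degree h" unfolding h using m(1) by (rule degree_mult_eq[rotated])
        then have "degree h < ?N" using degree_\<phi>[of f d] f U(2) by auto
        moreover have "\<phi> f div m = h" unfolding h using m(1) by simp
        ultimately have "coeff h (degree h) = 0" using z by simp
        then show False using \<open>h \<noteq> 0\<close> by simp
      qed
      then have "\<phi> f = 0" using h by simp
      then obtain H where H: "H \<in> forms (d - 3)" "d < 3 \<Longrightarrow> H = 0" "f = F * H"
        using \<phi>_kernel[of f d] f U(2) by blast
      then have "H \<in> ?V" using V(2)[OF H(1)] f by auto
      then show "f \<in> (*) F ` ?V" using H(3) by blast
    qed
    show "(*) F ` ?V \<subseteq> form_space.span B'"
    proof safe
      fix H assume H: "H \<in> ?V"
      have "F * H \<in> forms d"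
      proof (cases "d < 3")
        case True
        then show ?thesis using H by simp
      next
        case False
        then have "H \<in> forms (d - 3)" "3 + (d - 3) = d" using H V(3) by auto
        then show ?thesis using forms_mult[OF F_in_forms] by metis
      qed
      then show "F * H \<in> form_space.span B'" using B'(2) by blast
    qed
    fix i x y c
    show "coeff (\<phi> (x + y) div m) i = coeff (\<phi> x div m) i + coeff (\<phi> y div m) i"
      unfolding psubst_simps poly_div_add_left coeff_add ..
    show "coeff (\<phi> (const c * x) div m) i = c * coeff (\<phi> x div m) i"
      unfolding psubst_simps by (simp add: div_smult_left)
  qed (fact U(1), fact B(1), fact B'(1))
  also have "form_space.dim ((*) F ` ?V) = form_space.dim ?V"
  proof (rule form_space.dim_inj_image)
    show "form_space.subspace ?V" using V(1) form_space.subspace_single_0 by simp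
    show "inj_on ((*) F) ?V" using F_neq_0 by (intro inj_onI) simp
  qed (simp_all only: distrib_left mult.left_commute)
  finally show ?thesis by (simp add: form_space_dim_zero split: if_splits)
qed

text \<open>The point \<open>\<psi> s\<close> scaled to \<open>Y = 1\<close>; meaningless when \<open>poly q s = 0\<close>.\<close>

definition pt :: "'k \<Rightarrow> 'k ^ 3"
  where "pt s = s *s u + v + (- poly k s / poly q s) *s w"

lemma \<phi>_eval_pt:
  assumes "f \<in> forms d" "poly q s \<noteq> 0"
  shows "poly (\<phi> f) s = poly q s ^ d * eval f (pt s)"
proof -
  have "(\<chi> i. poly (\<psi> i) s) = poly q s *s pt s"
    using assms(2) by (simp add: vec_eq_iff \<psi>_def pt_def field_simps)
  then show ?thesis unfolding poly_psubst using eval_scale[OF assms(1)] by simp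
qed

lemma eval_F_pt: "poly q s \<noteq> 0 \<Longrightarrow> eval F (pt s) = 0"
  using \<phi>_eval_pt[OF F_in_forms, of s] \<phi>_F by simp

text \<open>At parameter \<open>s\<close> the curve passes through \<open>pt s\<close>. This is the
  input to the divisibility of restricted forms by \<open>(x - s)\<close> and its square.\<close>

lemma linear_dvd_\<psi>:
  assumes "poly q s \<noteq> 0"
  shows "[:-s, 1:] dvd \<psi> i - [:poly q s:] * [:pt s $ i:]"
  unfolding poly_eq_0_iff_dvd[symmetric] using assms by (simp add: \<psi>_def pt_def field_simps)

text \<open>Modulo the whole of \<open>q\<close> the curve stays at \<open>w\<close> up to the
  scalar \<open>- k\<close>. Hence forms through \<open>w\<close> gain the factor \<open>q\<close>
  even when \<open>q\<close> has a double root, the case of a cusp.\<close>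

lemma q_dvd_\<psi>: "q dvd \<psi> i - (- k) * [:w $ i:]"
proof -
  have "\<psi> i - (- k) * [:w $ i:] = q * [:v $ i, u $ i:]"
    unfolding \<psi>_def by (simp only: mult_minus_left diff_minus_eq_add diff_add_cancel)
  then show ?thesis by (simp only: dvd_triv_left)
qed

lemma dot_pt: "dot xs (pt s) = s" "dot ys (pt s) = 1" "dot zs (pt s) = - poly k s / poly q s"
proof -
  have dot_linear: "dot a (b + c) = dot a b + dot a c" "dot a (e *s b) = e * dot a b" for a b c :: "'k ^ 3" and e
    unfolding dot_def sum_3 by (simp_all add: algebra_simps)
  show "dot xs (pt s) = s" "dot ys (pt s) = 1" "dot zs (pt s) = - poly k s / poly q s"
    unfolding pt_def dot_linear dual by simp_all
qed

text \<open>In the direction of \<open>w\<close> the equation \<open>Z q + k\<close> is linear with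
  slope \<open>q(s)\<close>. A nonzero slope says that the cubic is smooth at
  \<open>pt s\<close>.\<close>

lemma line_psubst_F:
  assumes "poly q s \<noteq> 0"
  shows "line_psubst (pt s) w F = [:0, poly q s:]"
proof -
  have XYZ: "line_psubst (pt s) w X = [:s:]" "line_psubst (pt s) w Y = 1"
    "line_psubst (pt s) w Z = [:- poly k s / poly q s, 1:]"
    unfolding X_def Y_def Z_def psubst_line_linear_form dual dot_pt by (simp_all add: one_pCons)
  have "line_psubst (pt s) w (homog m p) = [:poly p s:]" if "degree p \<le> m" for m p
  proof -
    have "line_psubst (pt s) w (homog m p) = (\<Sum>i\<le>m. [:coeff p i * s ^ i:])"
      unfolding psubst_homog XYZ by (intro sum.cong refl) (simp add: poly_const_pow)
    also have "\<dots> = [:\<Sum>i\<le>m. coeff p i * s ^ i:]" by (induction m) (simp_all)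
    also have "(\<Sum>i\<le>m. coeff p i * s ^ i) = (\<Sum>i\<le>degree p. coeff p i * s ^ i)"
      using that by (intro sum.mono_neutral_right) (auto simp: coeff_eq_0)
    finally show ?thesis by (simp add: poly_altdef)
  qed
  then show ?thesis
    unfolding F_eq psubst_simps XYZ using degree_q degree_k assms by simp
qed

text \<open>Along the line towards \<open>w\<close> the factor \<open>F\<close> vanishes only to
  first order, so the second zero of the product must come from \<open>H\<close>.\<close>

lemma F_mult_square_imp_eval_0:
  assumes "poly q s \<noteq> 0"
    "F * H \<in> ideal_prod coord_ring (point_ideal (vec.span {pt s})) (point_ideal (vec.span {pt s}))"
  shows "eval H (pt s) = 0"
proof -
  have "[:0, 1:]\<^sup>2 dvd line_psubst (pt s) w (F * H)"
    by (rule double_point_ideal_psubst_dvd[OF _ assms(2), where e = 1]) (auto simp: poly_eq_0_iff_dvd[of _ 0, simplified, symmetric])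
  then obtain g where "line_psubst (pt s) w (F * H) = [:0, 1:]\<^sup>2 * g" by blast
  then have "coeff (line_psubst (pt s) w (F * H)) 1 = 0" by (simp add: power2_eq_square)
  then have "poly q s * coeff (line_psubst (pt s) w H) 0 = 0"
    unfolding psubst_simps line_psubst_F[OF assms(1)] by simp
  then show ?thesis using assms(1) coeff_psubst_line_0[of "pt s" w H] by simp
qed

lemma F_in_square_ideal: "F \<in> I2_w"
proof -
  note I = coord_ring_idealD[OF square_ideal_is_ideal]
  have "Z * homog 2 q \<in> I2_w" by (intro I(3) homog_in_square_ideal) simp
  moreover have "homog 3 k \<in> I2_w" by (intro homog_in_square_ideal) simp
  ultimately show ?thesis unfolding F_eq mult.commute[of _ Z] by (rule I(2))
qed

end

section \<open>Forms through chosen points of the cubic, simple and double\<close>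

locale cubic_points = nodal_cuspidal_cubic +
  fixes S
  assumes finite_S: "finite S" and q_S: "\<And>s. s \<in> S \<Longrightarrow> poly q s \<noteq> 0"
begin

definition forms_through_S where "forms_through_S e = {H \<in> forms e. \<forall>s\<in>S. eval H (pt s) = 0}"

text \<open>Only the support; the double structure enters through
  \<open>double_point_ideal\<close>.\<close>

definition double_scheme where "double_scheme = insert (vec.span {w}) ((\<lambda>s. vec.span {pt s}) ` S)"

lemma subspace_forms_through_S: "form_space.subspace (forms_through_S e)"
  by (intro form_space.subspaceI)
    (auto simp: forms_through_S_def forms_add forms_const_mult eval_simps)

lemma dim_forms_le_forms_through_S:
  "form_space.dim (forms e :: 'a form_ring set) \<le> form_space.dim (forms_through_S e) + card S"
proof -
  obtain B where B: "finite B" "(forms e :: 'a form_ring set) \<subseteq> form_space.span B"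
    using forms_fin_spanned .
  show ?thesis unfolding forms_through_S_def
    by (rule form_space.dim_Ker_functionals[where f = "\<lambda>s f. eval f (pt s)", OF finite_S subspace_forms B(2,1)])
      (simp_all add: eval_simps)
qed

lemma dim_F_mult_le:
  assumes "form_space.subspace V" "(*) F ` V \<subseteq> U" "U \<subseteq> forms d"
  shows "form_space.dim V \<le> form_space.dim U"
proof -
  obtain B where B: "finite B" "(forms d :: 'a form_ring set) \<subseteq> form_space.span B"
    using forms_fin_spanned .
  have "form_space.dim ((*) F ` V) = form_space.dim V"
  proof (rule form_space.dim_inj_image)
    show "inj_on ((*) F) V" using F_neq_0 by (intro inj_onI) simp
  qed (simp_all only: distrib_left mult.left_commute assms(1))
  moreover have "form_space.dim ((*) F ` V) \<le> form_space.dim U"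
    using form_space.dim_mono_fin[OF assms(2) _ B(1)] assms(3) B(2) by blast
  ultimately show ?thesis by simp
qed

lemma dim_forms_through_S_lower:
  "form_space.dim (forms e :: 'a form_ring set) \<le> form_space.dim (forms_through_S (e + 3))"
proof (rule dim_F_mult_le[OF subspace_forms])
  show "(*) F ` forms e \<subseteq> forms_through_S (e + 3)"
    using forms_mult[OF _ F_in_forms, of _ e] q_S eval_F_pt
    by (auto simp: forms_through_S_def eval_conv_subst eval_hom.subst_mult mult.commute[of F])
qed (auto simp: forms_through_S_def)

text \<open>Imposing one more zero at \<open>w\<close> costs one dimension but gains the factor \<open>q\<close> of degree two; this saves the
  dimension that the curve \<open>\<phi>\<close> does not reach, its image having codimension one in the polynomials of
  degree at most \<open>3 e\<close>.\<close>

lemma dim_forms_through_S_upper: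
  "form_space.dim (forms_through_S e) \<le> (if e < 3 then 0 else form_space.dim (forms (e - 3) :: 'a form_ring set))
    + (if 3 * e < card S then 0 else if 3 * e = card S then 1 else 3 * e - card S)"
proof -
  let ?m = "\<lambda>q. q * (\<Prod>s\<in>S. [:-s, 1:] ^ 1)"
  have dvd: "[:-s, 1:] ^ 1 dvd \<phi> f" if "f \<in> forms_through_S e" "s \<in> S" for f s
    using that \<phi>_eval_pt[of f e s] q_S by (simp add: forms_through_S_def flip: poly_eq_0_iff_dvd)
  show ?thesis
  proof (cases "3 * e < card S")
    \<comment> \<open>The product over \<open>S\<close> alone already exceeds the degree of the
      restricted forms, so no zero at \<open>w\<close> is imposed and no dimension is given
      away.\<close>
    case True
    have "form_space.dim (forms_through_S e) \<le> (if e < 3 then 0 else form_space.dim (forms (e - 3) :: 'a form_ring set))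
      + (3 * e + 1 - degree (?m 1))"
    proof (rule dim_le_of_\<phi>_dvd[OF subspace_forms_through_S _ subspace_forms])
      show "?m 1 dvd \<phi> f" if "f \<in> forms_through_S e" for f
        using dvd[OF that] by (intro mult_prod_linear_dvd finite_S) simp_all
      show "?m 1 \<noteq> 0" using finite_S by simp
    qed (auto simp: forms_through_S_def)
    moreover have "degree (?m 1) = card S" using degree_mult_prod_linear[OF finite_S, of 1 1] by simp
    ultimately show ?thesis using True by simp
  next
    case False
    let ?U = "{f \<in> forms_through_S e. eval f w = 0}"
    obtain B where B: "finite B" "(forms e :: 'a form_ring set) \<subseteq> form_space.span B"
      using forms_fin_spanned .
    have "form_space.dim (forms_through_S e) \<le> form_space.dim ?U + 1"
      by (rule form_space.dim_Ker_functional[where f = "\<lambda>f. eval f w", OF subspace_forms_through_S _ B(1)])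
        (use B(2) in \<open>auto simp: eval_simps forms_through_S_def\<close>)
    also have "form_space.dim ?U \<le> (if e < 3 then 0 else form_space.dim (forms (e - 3) :: 'a form_ring set))
      + (3 * e + 1 - degree (?m q))"
    proof (rule dim_le_of_\<phi>_dvd[OF _ _ subspace_forms])
      show "form_space.subspace ?U"
        using subspace_forms_through_S[of e] by (auto simp: form_space.subspace_def eval_simps)
      show "?m q dvd \<phi> f" if f: "f \<in> ?U" for f
      proof (rule mult_prod_linear_dvd[OF finite_S _ q_neq_0 q_S])
        have "f \<in> I_w" using f by (intro point_ideal_span_memI) (auto simp: forms_through_S_def)
        then show "q dvd \<phi> f" by (rule point_ideal_psubst_dvd[OF q_dvd_\<psi>])
      qed (use dvd f in auto)
      show "?m q \<noteq> 0" using finite_S q_neq_0 by simp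
    qed (auto simp: forms_through_S_def)
    \<comment> \<open>For \<open>3 e = card S\<close> the term \<open>3 e + 1 - (card S + 2)\<close>
      truncates to 0 and only the unit spent on the zero at \<open>w\<close> remains; above that the
      two together give \<open>3 e - card S\<close>.\<close>
    finally show ?thesis
      using degree_mult_prod_linear[OF finite_S q_neq_0, of 1] degree_q False by (auto split: if_splits)
  qed
qed

lemma F_mult_in_double_ideal:
  assumes "H \<in> forms_through_S e"
  shows "F * H \<in> double_point_ideal double_scheme"
  unfolding double_point_ideal_def
proof
  fix p assume "p \<in> double_scheme"
  then consider "p = vec.span {w}" | s where "s \<in> S" "p = vec.span {pt s}"
    by (auto simp: double_scheme_def)
  then show "F * H \<in> ideal_prod coord_ring (point_ideal p) (point_ideal p)"
  proof cases
    case 1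
    then show ?thesis
      using coord_ring_idealD(3)[OF square_ideal_is_ideal F_in_square_ideal, of H] by (simp add: mult.commute)
  next
    case 2
    have "F \<in> point_ideal p" "H \<in> point_ideal p"
      using 2 assms eval_F_pt[OF q_S] F_in_forms unfolding 2(2)
      by (auto intro!: point_ideal_span_memI simp: forms_through_S_def)
    then show ?thesis by (rule ideal_prod_mult_mem)
  qed
qed

lemma dim_double_ideal_lower:
  "form_space.dim (forms_through_S e) \<le> form_space.dim (double_point_ideal double_scheme \<inter> forms (e + 3))"
proof (rule dim_F_mult_le[OF subspace_forms_through_S])
  show "(*) F ` forms_through_S e \<subseteq> double_point_ideal double_scheme \<inter> forms (e + 3)"
  proof safe
    fix H assume H: "H \<in> forms_through_S e"
    show "F * H \<in> double_point_ideal double_scheme" by (rule F_mult_in_double_ideal[OF H])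
    show "F * H \<in> forms (e + 3)"
      using forms_mult[of H e F 3] H F_in_forms by (simp add: forms_through_S_def mult.commute)
  qed
qed auto

text \<open>The constant 4 is the degree of \<open>q^2\<close>. Being double at \<open>w\<close> is
  part of the membership, so this factor comes without an extra condition.\<close>

lemma dim_double_ideal_upper:
  "form_space.dim (double_point_ideal double_scheme \<inter> forms d)
    \<le> (if d < 3 then 0 else form_space.dim (forms_through_S (d - 3))) + (3 * d + 1 - (2 * card S + 4))"
proof -
  let ?m = "q\<^sup>2 * (\<Prod>s\<in>S. [:-s, 1:] ^ 2)"
  have sq: "f \<in> ideal_prod coord_ring (point_ideal p) (point_ideal p)"
    if "f \<in> double_point_ideal double_scheme" "p \<in> double_scheme" for f p
    using that by (auto simp: double_point_ideal_def)
  have "form_space.dim (double_point_ideal double_scheme \<inter> forms d)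
      \<le> (if d < 3 then 0 else form_space.dim (forms_through_S (d - 3))) + (3 * d + 1 - degree ?m)"
  proof (rule dim_le_of_\<phi>_dvd[OF subspace_ideal_forms[OF double_point_ideal_is_ideal] _ subspace_forms_through_S])
    show "H \<in> forms_through_S (d - 3)"
      if "H \<in> forms (d - 3)" "F * H \<in> double_point_ideal double_scheme \<inter> forms d" for H
      unfolding forms_through_S_def
      using that F_mult_square_imp_eval_0[OF q_S] sq[of "F * H"] by (auto simp: double_scheme_def)
    show "?m dvd \<phi> f" if f: "f \<in> double_point_ideal double_scheme \<inter> forms d" for f
    proof (rule mult_prod_linear_dvd[OF finite_S])
      show "q\<^sup>2 dvd \<phi> f"
        using f by (intro double_point_ideal_psubst_dvd[OF q_dvd_\<psi>] sq) (auto simp: double_scheme_def)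
      show "[:-s, 1:] ^ 2 dvd \<phi> f" if "s \<in> S" for s
        using f that by (intro double_point_ideal_psubst_dvd[OF linear_dvd_\<psi>[OF q_S[OF that]]] sq)
          (auto simp: double_scheme_def)
    qed (use q_neq_0 q_S in \<open>auto simp: poly_power\<close>)
    show "?m \<noteq> 0" using q_neq_0 finite_S by simp
  qed (auto simp: forms_through_S_def)
  moreover have "degree ?m = 2 * card S + 4"
    using degree_mult_prod_linear[OF finite_S, of "q\<^sup>2" 2] q_neq_0 degree_q by (simp add: degree_power_eq)
  ultimately show ?thesis by simp
qed

end

section \<open>Choice of a chart\<close>

lemma sum_const_poly: "(\<Sum>i\<in>A. [:f i:]) = [:\<Sum>i\<in>A. f i:]"
  by (induction A rule: infinite_finite_induct) simp_all

text \<open>A form of positive degree vanishes at the origin, a unit does not.\<close>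

lemma form_not_unit:
  assumes "f \<in> forms (Suc d)"
  shows "\<not> f dvd (1 :: 'k::field form_ring)"
proof
  assume "f dvd 1"
  then obtain g where g: "1 = f * g" by blast
  have "eval f 0 = 0" using eval_scale[OF assms, of 0 0] by simp
  moreover have "eval f 0 * eval g 0 = eval (1 :: 'k form_ring) 0"
    unfolding g by (simp add: eval_simps)
  ultimately show False by (simp add: eval_simps)
qed

lemma irreducible_form_not_product:
  assumes "irreducible (f * g :: 'k::field form_ring)" "f \<in> forms (Suc d)" "g \<in> forms (Suc e)"
  shows False
  using irreducibleD[OF assms(1) refl] form_not_unit assms(2,3) by blast

text \<open>Over a finite field, one plus the product of all \<open>x - a\<close> has positive
  degree and no root.\<close>

lemma infinite_UNIV_alg_closed: "infinite (UNIV :: 'k::alg_closed_field set)"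
proof
  assume fin: "finite (UNIV :: 'k set)"
  let ?p = "(\<Prod>a\<in>UNIV. [:-a, 1:]) + 1 :: 'k poly"
  have "degree (\<Prod>a\<in>UNIV. [:-a, 1:] :: 'k poly) = card (UNIV :: 'k set)"
    by (subst degree_prod_eq_sum_degree) auto
  moreover have "card (UNIV :: 'k set) > 0" using fin by (simp add: card_gt_0_iff)
  ultimately have "degree ?p > 0" by (subst degree_add_eq_left) simp_all
  then obtain x where "poly ?p x = 0" using alg_closed_imp_poly_has_root by blast
  moreover have "poly (\<Prod>a\<in>UNIV. [:-a, 1:]) x = 0" using fin by (simp add: poly_prod)
  ultimately show False by simp
qed

lemma dot_add_right: "dot a (b + c) = dot a b + dot a c"
  and dot_scale_right: "dot a (e *s b) = e * dot a b"
  and dot_add_left: "dot (a + b) c = dot a c + dot b c"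
  and dot_diff_left: "dot (a - b) c = dot a c - dot b c"
  and dot_scale_left: "dot (e *s a) b = e * dot a b"
  for a b c :: "'k::field ^ 3"
  unfolding dot_def sum_3 by (simp_all add: algebra_simps)

lemmas dot_linear = dot_add_right dot_scale_right dot_add_left dot_diff_left dot_scale_left

context plane_coords
begin

lemma singular_cubic_form:
  assumes "f \<in> forms 3" "eval f w = 0" "\<And>i. eval (partial_deriv i f) w = 0"
  obtains q k where "degree q \<le> 2" "degree k \<le> 3" "f = homog 2 q * Z + homog 3 k"
proof -
  have l: "coeff (line_psubst w b f) 1 = 0" for b
    unfolding coeff_psubst_line_1 assms(3) by simp
  show thesis
  proof (rule singular_form_expansion[OF assms(1,2) l l])
    fix p assume p: "\<forall>l\<le>3. degree (p l) \<le> 3 - l" "f = expand 3 3 p"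
      "\<And>l. l \<le> 3 \<Longrightarrow> 3 < l + 2 \<Longrightarrow> homog (3 - l) (p l) = 0"
    have "homog 1 (p 2) = 0" "homog 0 (p 3) = 0" using p(3)[of 2] p(3)[of 3] by simp_all
    moreover have "f = homog 3 (p 0) + homog 2 (p 1) * Z + homog 1 (p 2) * Z ^ 2 + homog 0 (p 3) * Z ^ 3"
      unfolding p(2) expand_def by (simp add: numeral_3_eq_3 numeral_2_eq_2)
    ultimately have "f = homog 2 (p 1) * Z + homog 3 (p 0)" by (simp add: add.commute)
    moreover have "degree (p 1) \<le> 2" "degree (p 0) \<le> 3"
      using p(1)[rule_format, of 1] p(1)[rule_format, of 0] by simp_all
    ultimately show thesis using that by blast
  qed
qed

text \<open>At a common root \<open>s\<close> the linear form \<open>X - s Y\<close> divides both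
  parts, hence the cubic.\<close>

lemma irreducible_no_common_root:
  assumes "irreducible (homog 2 q * Z + homog 3 k)" "degree q \<le> 2" "degree k \<le> 3" "poly q s = 0"
  shows "poly k s \<noteq> 0"
proof
  assume "poly k s = 0"
  then obtain q' k' where f: "q = [:-s, 1:] * q'" "k = [:-s, 1:] * k'"
    using assms(4) unfolding poly_eq_0_iff_dvd dvd_def by blast
  have "degree q' \<le> 1"
    using assms(2) unfolding f by (cases "q' = 0") (auto simp: degree_mult_eq simp del: mult_pCons_left)
  moreover have "degree k' \<le> 2"
    using assms(3) unfolding f by (cases "k' = 0") (auto simp: degree_mult_eq simp del: mult_pCons_left)
  ultimately have "homog 2 q = homog 1 [:-s, 1:] * homog 1 q'" "homog 3 k = homog 1 [:-s, 1:] * homog 2 k'"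
    using homog_mult[of "[:-s, 1:]" 1 q' 1] homog_mult[of "[:-s, 1:]" 1 k' 2]
    unfolding f by (simp_all add: numeral_3_eq_3 numeral_2_eq_2)
  then have eq: "homog 2 q * Z + homog 3 k = homog 1 [:-s, 1:] * (homog 1 q' * Z + homog 2 k')"
    by (simp only: distrib_left mult.assoc)
  have "homog 1 [:-s, 1:] \<in> forms (Suc 0)" using homog_in_forms[of 1] by simp
  moreover have "homog 1 q' * Z + homog 2 k' \<in> forms (Suc 1)"
    using forms_add[OF forms_mult[OF homog_in_forms[of 1 q'] XYZ_in_forms(3)], of "homog 2 k'"] homog_in_forms[of 2 k']
    by (simp add: numeral_2_eq_2)
  ultimately show False using irreducible_form_not_product assms(1) unfolding eq by blast
qed

end

text \<open>With \<open>q = 0\<close> the cubic is a binary form and has a linear factor: one given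
  by a root of \<open>k\<close>, or \<open>Y\<close> when \<open>k\<close> is constant.\<close>

lemma (in plane_coords) irreducible_quadratic_part_neq_0:
  fixes q k :: "'k poly"
  assumes "irreducible (homog 2 q * Z + homog 3 k)" "degree k \<le> 3"
    and root: "\<And>p :: 'k poly. degree p > 0 \<Longrightarrow> \<exists>s. poly p s = 0"
  shows "q \<noteq> 0"
proof
  assume q: "q = 0"
  show False
  proof (cases "degree k > 0")
    case True
    then show False using root irreducible_no_common_root[OF assms(1) _ assms(2)] q by auto
  next
    case False
    then have "homog 3 k = Y * homog 2 k" using Y_mult_homog[of k 2] by (simp add: numeral_3_eq_3 numeral_2_eq_2)
    moreover have "Y \<in> forms (Suc 0)" "homog 2 k \<in> forms (Suc 1)"
      using XYZ_in_forms(2) homog_in_forms[of 2 k] by (simp_all add: numeral_2_eq_2)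
    ultimately show False using irreducible_form_not_product[of Y "homog 2 k"] assms(1) q by auto
  qed
qed

context plane_coords
begin

text \<open>Turns the line \<open>Y = 0\<close> about \<open>w\<close>, so that it passes through
  \<open>u + c v\<close>; \<open>X\<close>, \<open>Z\<close> and the point \<open>w\<close> are
  kept.\<close>

lemma shear: "plane_coords (u + c *s v) v w xs (ys - c *s xs) zs"
proof
  fix i j
  have "(u + c *s v) $ i * xs $ j + v $ i * (ys - c *s xs) $ j + w $ i * zs $ j
      = u $ i * xs $ j + v $ i * ys $ j + w $ i * zs $ j" by (simp add: algebra_simps)
  then show "(u + c *s v) $ i * xs $ j + v $ i * (ys - c *s xs) $ j + w $ i * zs $ j = (if i = j then 1 else 0)"
    unfolding complete .
qed (simp_all add: dot_linear dual)

text \<open>The left side refers to \<open>a\<close>, \<open>w\<close> and the cubic alone, the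
  right side is the tangent cone at \<open>w\<close> evaluated at \<open>a\<close>. So the cone can
  be compared between two charts without transforming \<open>q\<close>.\<close>

lemma coeff_line_psubst_cubic:
  "coeff (line_psubst a w (homog 2 q * Z + homog 3 k)) 1 = (\<Sum>i\<le>2. coeff q i * dot xs a ^ i * dot ys a ^ (2 - i))"
proof -
  have XYZ: "line_psubst a w X = [:dot xs a:]" "line_psubst a w Y = [:dot ys a:]" "line_psubst a w Z = [:dot zs a, 1:]"
    unfolding X_def Y_def Z_def psubst_line_linear_form dual by simp_all
  have "line_psubst a w (homog m p) = [:\<Sum>i\<le>m. coeff p i * dot xs a ^ i * dot ys a ^ (m - i):]" for m p
  proof -
    have "line_psubst a w (homog m p) = (\<Sum>i\<le>m. [:coeff p i * dot xs a ^ i * dot ys a ^ (m - i):])"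
      unfolding psubst_homog XYZ by (intro sum.cong refl) (simp add: poly_const_pow)
    also have "\<dots> = [:\<Sum>i\<le>m. coeff p i * dot xs a ^ i * dot ys a ^ (m - i):]"
      by (rule sum_const_poly)
    finally show ?thesis .
  qed
  then show ?thesis unfolding psubst_simps XYZ by simp
qed

end

text \<open>The line \<open>Y = 0\<close> through \<open>w\<close> must be no tangent of the cubic
  and must miss every point of \<open>A\<close>. Among its turns about \<open>w\<close> only
  finitely many fail, and the field is infinite.\<close>

lemma singular_cubic_chart:
  fixes w :: "'k::alg_closed_field ^ 3"
  assumes F: "F \<in> forms 3" "irreducible F" "eval F w = 0" "\<And>i. eval (partial_deriv i F) w = 0"
    and w: "w \<noteq> 0" and A: "finite A" "\<And>a. a \<in> A \<Longrightarrow> a \<notin> vec.span {w}"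
  obtains u v xs ys zs q k where "nodal_cuspidal_cubic u v w xs ys zs F q k"
    "\<forall>a\<in>A. dot ys a \<noteq> 0"
proof -
  obtain u v xs ys zs where c: "plane_coords u v w xs ys zs"
    using exists_plane_coords[OF w] .
  interpret c: plane_coords u v w xs ys zs by (rule c)
  obtain q k where qk: "degree q \<le> 2" "degree k \<le> 3" "F = c.homog 2 q * c.Z + c.homog 3 k"
    using c.singular_cubic_form[OF F(1,3,4)] .
  have q0: "q \<noteq> 0"
    using c.irreducible_quadratic_part_neq_0[OF _ qk(2) alg_closed_imp_poly_has_root] F(2) qk(3) by blast
  \<comment> \<open>\<open>q\<close> with its coefficients reversed: \<open>poly r e\<close> is the
    tangent cone at \<open>u + e v\<close>, so its roots are the turns for which
    \<open>Y = 0\<close> becomes a tangent.\<close>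
  define r where "r = [:coeff q 2, coeff q 1, coeff q 0:]"
  have "r \<noteq> 0"
  proof
    assume "r = 0"
    then have "coeff q 2 = 0" "coeff q 1 = 0" "coeff q 0 = 0" by (simp_all add: r_def)
    moreover have "degree q = 0 \<or> degree q = 1 \<or> degree q = 2" using qk(1) by linarith
    ultimately show False using q0 by (metis leading_coeff_0_iff)
  qed
  have "finite {e. dot ys a = e * dot xs a}" if a: "a \<in> A" for a
  proof (cases "dot xs a = 0")
    case True
    have "dot ys a \<noteq> 0"
    proof
      assume "dot ys a = 0"
      then have "a = dot zs a *s w" using c.vec_decomp[of a] True by simp
      then have "a \<in> vec.span {w}" by (metis vec.span_base vec.span_scale singletonI)
      then show False using A(2)[OF a] by simp
    qed
    then show ?thesis using True by simp
  next
    case False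
    then have "{e. dot ys a = e * dot xs a} = {dot ys a / dot xs a}" by (auto simp: field_simps)
    then show ?thesis by simp
  qed
  then have "finite ({e. poly r e = 0} \<union> (\<Union>a\<in>A. {e. dot ys a = e * dot xs a}))"
    using A(1) poly_roots_finite[OF \<open>r \<noteq> 0\<close>] by simp
  then obtain e where "e \<notin> {e. poly r e = 0} \<union> (\<Union>a\<in>A. {e. dot ys a = e * dot xs a})"
    using ex_new_if_finite[OF infinite_UNIV_alg_closed] by blast
  then have e: "poly r e \<noteq> 0" "\<And>a. a \<in> A \<Longrightarrow> dot ys a \<noteq> e * dot xs a" by auto
  interpret d: plane_coords "u + e *s v" v w xs "ys - e *s xs" zs by (rule c.shear)
  obtain q' k' where qk': "degree q' \<le> 2" "degree k' \<le> 3" "F = d.homog 2 q' * d.Z + d.homog 3 k'"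
    using d.singular_cubic_form[OF F(1,3,4)] .
  \<comment> \<open>The leading coefficient of the new \<open>q'\<close> is the tangent cone at the
    new first basis vector, which the old chart computes as \<open>poly r e\<close>.\<close>
  have "coeff q' 2 = coeff (psubst (\<lambda>i. [:(u + e *s v) $ i, w $ i:]) F) 1"
    unfolding qk'(3) d.coeff_line_psubst_cubic d.dual by (simp add: numeral_2_eq_2)
  also have "\<dots> = poly r e"
    unfolding qk(3) c.coeff_line_psubst_cubic dot_linear c.dual
    by (simp add: numeral_2_eq_2 r_def algebra_simps)
  finally have "coeff q' 2 \<noteq> 0" using e(1) by simp
  then have "degree q' = 2" using qk'(1) le_degree[of q' 2] by simp
  moreover have "poly k' s \<noteq> 0" if "poly q' s = 0" for s
    using d.irreducible_no_common_root[OF _ qk'(1,2) that] F(2) qk'(3) by simp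
  ultimately have "nodal_cuspidal_cubic (u + e *s v) v w xs (ys - e *s xs) zs F q' k'"
    using qk' by unfold_locales
  moreover have "\<forall>a\<in>A. dot (ys - e *s xs) a \<noteq> 0"
    using e(2) by (simp add: dot_linear)
  ultimately show thesis by (rule that)
qed

section \<open>The parametrization reaches the points of the curve in the chart, without
  repetition\<close>

context nodal_cuspidal_cubic
begin

lemma inj_pt_span: "inj (\<lambda>s. vec.span {pt s})"
proof (rule injI)
  fix s s' assume "vec.span {pt s} = vec.span {pt s'}"
  then have "pt s \<in> vec.span {pt s'}" using vec.span_base by blast
  then obtain c where c: "pt s = c *s pt s'" by (auto simp: vec.span_singleton)
  have "1 = c" using arg_cong[OF c, of "dot ys"] by (simp add: dot_linear dot_pt)
  then show "s = s'" using arg_cong[OF c, of "dot xs"] by (simp add: dot_linear dot_pt)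
qed

lemma pt_span_neq: "vec.span {pt s} \<noteq> vec.span {w}"
proof
  assume "vec.span {pt s} = vec.span {w}"
  then have "pt s \<in> vec.span {w}" using vec.span_base by blast
  then obtain c where c: "pt s = c *s w" by (auto simp: vec.span_singleton)
  show False using arg_cong[OF c, of "dot ys"] by (simp add: dot_linear dot_pt dual)
qed

lemma eval_F_affine: "eval F (s *s u + v + z *s w) = poly q s * z + poly k s"
proof -
  let ?a = "s *s u + v + z *s w"
  have XYZ: "eval X ?a = s" "eval Y ?a = 1" "eval Z ?a = z"
    unfolding X_def Y_def Z_def eval_linear_form dot_linear dual by simp_all
  have "eval (homog m p) ?a = poly p s" if "degree p \<le> m" for m p
  proof -
    have "eval (homog m p) ?a = (\<Sum>i\<le>m. coeff p i * eval X ?a ^ i * eval Y ?a ^ (m - i))"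
      unfolding homog_def eval_simps ..
    also have "\<dots> = (\<Sum>i\<le>degree p. coeff p i * s ^ i)"
      unfolding XYZ using that by (simp, intro sum.mono_neutral_right) (auto simp: coeff_eq_0)
    finally show ?thesis by (simp add: poly_altdef)
  qed
  moreover have "eval F ?a = eval (homog 2 q) ?a * eval Z ?a + eval (homog 3 k) ?a"
    unfolding F_eq eval_conv_subst eval_hom.subst_add eval_hom.subst_mult ..
  ultimately show ?thesis using degree_q degree_k by (simp add: XYZ)
qed

text \<open>For fixed \<open>s\<close> the equation is linear in \<open>z\<close>. If its slope
  \<open>q(s)\<close> were 0, then \<open>k(s)\<close> would vanish too.\<close>

lemma point_on_curve_eq_pt:
  assumes "a = s *s u + v + z *s w" "eval F a = 0"
  shows "poly q s \<noteq> 0" "a = pt s"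
proof -
  have z: "poly q s * z + poly k s = 0" using assms eval_F_affine by simp
  then show q: "poly q s \<noteq> 0" using no_common_root[of s] by auto
  have "z = - poly k s / poly q s" using z q by (simp add: field_simps eq_neg_iff_add_eq_0)
  then show "a = pt s" using assms(1) by (simp add: pt_def)
qed

end

context cubic_points
begin

lemma card_double_scheme: "finite double_scheme" "card double_scheme = card S + 1"
proof -
  show "finite double_scheme" by (simp add: double_scheme_def finite_S)
  have "vec.span {w} \<notin> (\<lambda>s. vec.span {pt s}) ` S" using pt_span_neq by auto
  then show "card double_scheme = card S + 1"
    unfolding double_scheme_def using finite_S card_image[OF inj_on_subset[OF inj_pt_span subset_UNIV]] by simp
qed

lemma double_scheme_in_plane: "double_scheme \<subseteq> proj_plane"
proof -
  have "w \<noteq> 0" using dual by (auto simp: dot_def)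
  moreover have "pt s \<noteq> 0" for s using dot_pt(2)[of s] by (auto simp: dot_def)
  ultimately show ?thesis by (auto simp: double_scheme_def proj_plane_def)
qed

lemma hilbert_function_double_scheme:
  "hilbert_function (double_point_ideal double_scheme) d
    + form_space.dim (double_point_ideal double_scheme \<inter> forms d) = form_space.dim (forms d :: 'a form_ring set)"
proof (rule hilbert_function_eq_dim[OF double_point_ideal_is_ideal])
  show "1 \<notin> double_point_ideal double_scheme"
  proof
    assume "1 \<in> double_point_ideal double_scheme"
    then have "1 \<in> I2_w" by (simp add: double_point_ideal_def double_scheme_def)
    \<comment> \<open>The restriction to the curve detects properness: a polynomial of degree 4
      cannot divide 1.\<close>
    then have "q\<^sup>2 dvd \<phi> 1" by (rule double_point_ideal_psubst_dvd[OF q_dvd_\<psi>])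
    then have "q\<^sup>2 dvd 1" by (simp only: psubst.subst_1)
    then have "degree (q\<^sup>2) = 0" by (metis is_unit_iff_degree not_one_le_zero one_neq_zero dvd_0_left_iff)
    then show False using q_neq_0 degree_q by (simp add: degree_power_eq)
  qed
qed

end

text \<open>Here \<open>N\<close>, \<open>a\<close> and \<open>b\<close> are the dimensions of the
  graded pieces of \<open>R\<close>, \<open>I_Y\<close> and \<open>I_Z\<close>, and \<open>n\<close>
  is the size of \<open>Y\<close>. With \<open>d = e + 3\<close>, comparing \<open>3 d\<close> with
  \<open>n + 9\<close> is comparing \<open>3 e\<close> with \<open>n\<close>; the bound
  \<open>2 n + 3\<close> is one less than the degree of the divisor of restricted forms.\<close>

lemma hilbert_function_arith:
  fixes h a b N :: "nat \<Rightarrow> nat"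
  assumes N: "\<And>d. 2 * N d = (d + 1) * (d + 2)"
    and A: "\<And>e. N e \<le> a e + n" "\<And>e. N e \<le> a (e + 3)"
      "\<And>e. a e \<le> (if e < 3 then 0 else N (e - 3)) + (if 3 * e < n then 0 else if 3 * e = n then 1 else 3 * e - n)"
    and B: "\<And>d. N d \<le> b d + 3 * (n + 1)" "\<And>e. a e \<le> b (e + 3)"
      "\<And>d. b d \<le> (if d < 3 then 0 else a (d - 3)) + (3 * d + 1 - (2 * n + 4))"
    and h: "\<And>d. h d + b d = N d" and n: "n > 6"
  shows "d \<le> 5 \<Longrightarrow> h d = N d"
    and "4 \<le> d \<Longrightarrow> 3 * d < n + 9 \<Longrightarrow> 3 * d \<le> 2 * n + 3 \<Longrightarrow> h d + 9 = 6 * d"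
    and "4 \<le> d \<Longrightarrow> 3 * d = n + 9 \<Longrightarrow> 3 * d \<le> 2 * n + 3 \<Longrightarrow> h d + 9 = 6 * d \<or> h d + 10 = 6 * d"
    and "4 \<le> d \<Longrightarrow> n + 9 < 3 * d \<Longrightarrow> 3 * d \<le> 2 * n + 3 \<Longrightarrow> h d = 3 * d + n"
    and "4 \<le> d \<Longrightarrow> n + 9 < 3 * d \<Longrightarrow> 2 * n + 3 \<le> 3 * d \<Longrightarrow> h d = 3 * n + 3"
proof -
  have N3: "N (e + 3) = N e + 3 * (e + 3)" for e
    using N[of e] N[of "e + 3"] by (simp add: algebra_simps)
  have N012: "N 0 = 1" "N 1 = 3" "N 2 = 6" using N[of 0] N[of 1] N[of 2] by simp_all
  \<comment> \<open>Since \<open>3 e \<le> 6 < n\<close>, no nonzero form of degree at most 2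
    vanishes on \<open>Y\<close>; so none of degree at most 5 is double along
    \<open>X\<close>.\<close>
  have a_small: "a e = 0" if "e \<le> 2" for e using A(3)[of e] that n by simp
  have b_eq: "b (e + 3) = a e" if "3 * e + 6 \<le> 2 * n" for e
    using B(2)[of e] B(3)[of "e + 3"] that by simp
  show "h d = N d" if "d \<le> 5"
  proof (cases "d < 3")
    case True
    then show ?thesis using B(3)[of d] h[of d] n by simp
  next
    case False
    then obtain e where e: "d = e + 3" using le_Suc_ex[of 3 d] by (metis add.commute not_less)
    then show ?thesis using b_eq[of e] a_small[of e] h[of d] that n by simp
  qed
  fix d :: nat assume "4 \<le> d"
  define e where "e = d - 3"
  have e: "d = e + 3" "e \<ge> 1" using \<open>4 \<le> d\<close> by (simp_all add: e_def)
  define M where "M = (if e < 3 then 0 else N (e - 3))"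
  \<comment> \<open>Writing \<open>N e\<close> and \<open>N d\<close> as \<open>M\<close> plus
    linear terms leaves only linear arithmetic. The identity fails for \<open>e = 0\<close>, which
    is why the formulas start at \<open>d = 4\<close>.\<close>
  have NM: "N e = M + 3 * e"
  proof (cases "e < 3")
    case True
    then have "e = 1 \<or> e = 2" using e(2) by linarith
    then show ?thesis using N012 by (auto simp: M_def)
  next
    case False
    then show ?thesis using N3[of "e - 3"] by (simp add: M_def)
  qed
  have Nd: "N d = M + 6 * e + 9" using N3[of e] NM e(1) by simp
  have lower: "M \<le> a e"
  proof (cases "e < 3")
    case False
    then show ?thesis using A(2)[of "e - 3"] by (simp add: M_def)
  qed (simp add: M_def)
  have upper: "a e \<le> M + (if 3 * e < n then 0 else if 3 * e = n then 1 else 3 * e - n)"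
    using A(3)[of e] by (simp add: M_def)
  have a1: "M + 3 * e \<le> a e + n" using A(1)[of e] NM by simp
  have b: "b d \<le> a e + (3 * d + 1 - (2 * n + 4))" "a e \<le> b d" "N d \<le> b d + 3 * (n + 1)"
    using B(3)[of d] B(2)[of e] B(1)[of d] e(1) by simp_all
  note facts = h[of d] Nd lower upper a1 b e
  show "h d + 9 = 6 * d" if "3 * d < n + 9" "3 * d \<le> 2 * n + 3"
    using facts that by simp
  show "h d + 9 = 6 * d \<or> h d + 10 = 6 * d" if "3 * d = n + 9" "3 * d \<le> 2 * n + 3"
    using facts that by simp linarith
  show "h d = 3 * d + n" if "n + 9 < 3 * d" "3 * d \<le> 2 * n + 3"
    using facts that by simp
  show "h d = 3 * n + 3" if "n + 9 < 3 * d" "2 * n + 3 \<le> 3 * d"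
    using facts that by simp
qed

section \<open>Hilbert differences\<close>

lemma span_singleton_eqI:
  assumes "a \<in> vec.span {w}" "a \<noteq> (0 :: 'k::field ^ 3)"
  shows "vec.span {a} = vec.span {w}"
proof -
  obtain c where c: "a = c *s w" using assms(1) by (auto simp: vec.span_singleton)
  then have "c \<noteq> 0" using assms(2) by auto
  then have "w = inverse c *s a" unfolding c by simp
  then have "w \<in> vec.span {a}" by (metis vec.span_base vec.span_scale singletonI)
  then show ?thesis using assms(1) by (intro vec.span_eq[THEN iffD2]) simp
qed

text \<open>The values 5, 4, 2 and 1 arise in degrees where a change of slope falls between two
  integers, so they depend on \<open>n\<close> modulo 3.\<close>

lemma hilbert_diff_arith:
  fixes h N :: "nat \<Rightarrow> nat" and \<Delta>h :: "nat \<Rightarrow> int"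
  assumes N: "\<And>d. 2 * N d = (d + 1) * (d + 2)"
    and h: "\<And>d. d \<le> 5 \<Longrightarrow> h d = N d"
      "\<And>d. 4 \<le> d \<Longrightarrow> 3 * d < n + 9 \<Longrightarrow> 3 * d \<le> 2 * n + 3 \<Longrightarrow> h d + 9 = 6 * d"
      "\<And>d. 4 \<le> d \<Longrightarrow> 3 * d = n + 9 \<Longrightarrow> 3 * d \<le> 2 * n + 3 \<Longrightarrow> h d + 9 = 6 * d \<or> h d + 10 = 6 * d"
      "\<And>d. 4 \<le> d \<Longrightarrow> n + 9 < 3 * d \<Longrightarrow> 3 * d \<le> 2 * n + 3 \<Longrightarrow> h d = 3 * d + n"
      "\<And>d. 4 \<le> d \<Longrightarrow> n + 9 < 3 * d \<Longrightarrow> 2 * n + 3 \<le> 3 * d \<Longrightarrow> h d = 3 * n + 3"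
    and n: "n + 1 = 3 * t + \<delta>" "\<delta> \<le> 2" "t > 3"
    and \<Delta>h: "\<And>i. \<Delta>h i = int (h i) - (if i = 0 then 0 else int (h (i - 1)))"
  shows "(\<forall>i\<le>5. \<Delta>h i = int i + 1) \<and>
    (\<forall>i\<in>{5..t + 2}. \<Delta>h i = 6) \<and>
    (\<delta> = 0 \<longrightarrow>
      \<Delta>h (t + 3) = 5 \<and> (\<forall>i\<in>{t + 4..2 * t}. \<Delta>h i = 3) \<and>
      \<Delta>h (2 * t + 1) = 1 \<and> (\<forall>i\<ge>2 * t + 2. \<Delta>h i = 0)) \<and>
    (\<delta> = 1 \<longrightarrow>
      (\<Delta>h (t + 3) = 6 \<and> (\<forall>i\<in>{t + 4..2 * t + 1}. \<Delta>h i = 3) \<and>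
       (\<forall>i\<ge>2 * t + 2. \<Delta>h i = 0)) \<or>
      (\<Delta>h (t + 3) = 5 \<and> \<Delta>h (t + 4) = 4 \<and>
       (\<forall>i\<in>{t + 5..2 * t + 1}. \<Delta>h i = 3) \<and> (\<forall>i\<ge>2 * t + 2. \<Delta>h i = 0))) \<and>
    (\<delta> = 2 \<longrightarrow>
      \<Delta>h (t + 3) = 6 \<and> \<Delta>h (t + 4) = 4 \<and>
      (\<forall>i\<in>{t + 5..2 * t + 1}. \<Delta>h i = 3) \<and>
      \<Delta>h (2 * t + 2) = 2 \<and> (\<forall>i\<ge>2 * t + 3. \<Delta>h i = 0))"
proof (intro conjI impI)
  have step: "\<Delta>h i = int (h i) - int (h (i - 1))" if "i > 0" for i
    using that by (simp add: \<Delta>h)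
  have step_Suc: "\<Delta>h i = int (h i) - int (h j)" if "i = Suc j" for i j
    using that by (simp add: \<Delta>h)
  have low: "h i = 6 * i - 9" if "4 \<le> i" "i \<le> t + 2" for i
    using h(2)[of i] that n by simp
  show "\<forall>i\<le>5. \<Delta>h i = int i + 1"
  proof (intro allI impI)
    fix i :: nat assume i: "i \<le> 5"
    show "\<Delta>h i = int i + 1"
    proof (cases i)
      case 0
      then show ?thesis using \<Delta>h[of 0] h(1)[of 0] N[of 0] by simp
    next
      case (Suc j)
      then show ?thesis
        using \<Delta>h[of i] h(1)[of i] h(1)[of j] N[of i] N[of j] i by (simp add: algebra_simps)
    qed
  qed
  show "\<forall>i\<in>{5..t + 2}. \<Delta>h i = 6"
  proof
    fix i assume "i \<in> {5..t + 2}"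
    then have "4 \<le> i" "i \<le> t + 2" "4 \<le> i - 1" "i - 1 \<le> t + 2" by auto
    then show "\<Delta>h i = 6" using step[of i] low[of i] low[of "i - 1"] by simp
  qed
  have l2: "h (t + 2) = 6 * t + 3" using low[of "t + 2"] n by simp
  {
    assume \<delta>: "\<delta> = 0"
    have mid: "h i = 3 * i + n" if "t + 3 \<le> i" "i \<le> 2 * t" for i
      using h(4)[of i] that \<delta> n by simp
    have high: "h i = 9 * t" if "2 * t + 1 \<le> i" for i
      using h(5)[of i] that \<delta> n by simp
    show "\<Delta>h (t + 3) = 5" using step_Suc[of "t + 3" "t + 2"] l2 mid[of "t + 3"] \<delta> n by simp
    show "\<forall>i\<in>{t + 4..2 * t}. \<Delta>h i = 3"
    proof
      fix i assume "i \<in> {t + 4..2 * t}"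
      then have "t + 3 \<le> i" "i \<le> 2 * t" "t + 3 \<le> i - 1" "i - 1 \<le> 2 * t" "i > 0" by auto
      then show "\<Delta>h i = 3" using step[of i] mid[of i] mid[of "i - 1"] by simp
    qed
    show "\<Delta>h (2 * t + 1) = 1" using step_Suc[of "2 * t + 1" "2 * t"] high[of "2 * t + 1"] mid[of "2 * t"] \<delta> n by simp
    show "\<forall>i\<ge>2 * t + 2. \<Delta>h i = 0"
    proof (intro allI impI)
      fix i assume "i \<ge> 2 * t + 2"
      then have "2 * t + 1 \<le> i" "2 * t + 1 \<le> i - 1" "i > 0" by auto
      then show "\<Delta>h i = 0" using step[of i] high[of i] high[of "i - 1"] by simp
    qed
  }
  {
    assume \<delta>: "\<delta> = 2"
    have l3: "h (t + 3) = 6 * t + 9" using h(2)[of "t + 3"] \<delta> n by simp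
    have mid: "h i = 3 * i + n" if "t + 4 \<le> i" "i \<le> 2 * t + 1" for i
      using h(4)[of i] that \<delta> n by simp
    have high: "h i = 9 * t + 6" if "2 * t + 2 \<le> i" for i
      using h(5)[of i] that \<delta> n by simp
    show "\<Delta>h (t + 3) = 6" using step_Suc[of "t + 3" "t + 2"] l2 l3 by simp
    show "\<Delta>h (t + 4) = 4" using step_Suc[of "t + 4" "t + 3"] l3 mid[of "t + 4"] \<delta> n by simp
    show "\<forall>i\<in>{t + 5..2 * t + 1}. \<Delta>h i = 3"
    proof
      fix i assume "i \<in> {t + 5..2 * t + 1}"
      then have "t + 4 \<le> i" "i \<le> 2 * t + 1" "t + 4 \<le> i - 1" "i - 1 \<le> 2 * t + 1" "i > 0" by auto
      then show "\<Delta>h i = 3" using step[of i] mid[of i] mid[of "i - 1"] by simp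
    qed
    show "\<Delta>h (2 * t + 2) = 2" using step_Suc[of "2 * t + 2" "2 * t + 1"] high[of "2 * t + 2"] mid[of "2 * t + 1"] \<delta> n by simp
    show "\<forall>i\<ge>2 * t + 3. \<Delta>h i = 0"
    proof (intro allI impI)
      fix i assume "i \<ge> 2 * t + 3"
      then have "2 * t + 2 \<le> i" "2 * t + 2 \<le> i - 1" "i > 0" by auto
      then show "\<Delta>h i = 0" using step[of i] high[of i] high[of "i - 1"] by simp
    qed
  }
  assume \<delta>: "\<delta> = 1"
  have mid: "h i = 3 * i + n" if "t + 4 \<le> i" "i \<le> 2 * t + 1" for i
    using h(4)[of i] that \<delta> n by simp
  have high: "h i = 9 * t + 3" if "2 * t + 1 \<le> i" for i
    using h(5)[of i] that \<delta> n by simp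
  have d4: "\<Delta>h (t + 4) = int (6 * t + 12) - int (h (t + 3))"
    using step_Suc[of "t + 4" "t + 3"] mid[of "t + 4"] \<delta> n by simp
  have d5: "\<Delta>h i = 3" if "t + 5 \<le> i" "i \<le> 2 * t + 1" for i
  proof -
    have "t + 4 \<le> i" "t + 4 \<le> i - 1" "i - 1 \<le> 2 * t + 1" "i > 0" using that by auto
    then show ?thesis using step[of i] mid[of i] mid[of "i - 1"] that by simp
  qed
  have d_high: "\<forall>i\<ge>2 * t + 2. \<Delta>h i = 0"
  proof (intro allI impI)
    fix i assume "i \<ge> 2 * t + 2"
    then have "2 * t + 1 \<le> i" "2 * t + 1 \<le> i - 1" "i > 0" by auto
    then show "\<Delta>h i = 0" using step[of i] high[of i] high[of "i - 1"] by simp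
  qed
  \<comment> \<open>The degree \<open>t + 3\<close> lies exactly on the undecided break
    \<open>3 d = n + 9\<close>. Both neighbouring values of \<open>h\<close> are known, so the
    choice affects only the differences at \<open>t + 3\<close> and \<open>t + 4\<close>.\<close>
  consider "h (t + 3) = 6 * t + 9" | "h (t + 3) = 6 * t + 8"
    using h(3)[of "t + 3"] \<delta> n by force
  then show "(\<Delta>h (t + 3) = 6 \<and> (\<forall>i\<in>{t + 4..2 * t + 1}. \<Delta>h i = 3) \<and> (\<forall>i\<ge>2 * t + 2. \<Delta>h i = 0)) \<or>
      (\<Delta>h (t + 3) = 5 \<and> \<Delta>h (t + 4) = 4 \<and> (\<forall>i\<in>{t + 5..2 * t + 1}. \<Delta>h i = 3) \<and> (\<forall>i\<ge>2 * t + 2. \<Delta>h i = 0))"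
  proof cases
    case 1
    then have "\<Delta>h (t + 3) = 6" "\<Delta>h (t + 4) = 3" using step_Suc[of "t + 3" "t + 2"] l2 d4 by simp_all
    moreover have "\<Delta>h i = 3" if "i \<in> {t + 4..2 * t + 1}" for i
      using that d5[of i] \<open>\<Delta>h (t + 4) = 3\<close> by (cases "i = t + 4") simp_all
    ultimately show ?thesis using d_high by blast
  next
    case 2
    then have "\<Delta>h (t + 3) = 5" "\<Delta>h (t + 4) = 4" using step_Suc[of "t + 3" "t + 2"] l2 d4 by simp_all
    then show ?thesis using d_high d5 by simp
  qed
qed

theorem theorem3p7:
  fixes F :: "'k::alg_closed_field form_ring"
    and C X :: "('k ^ 3) set set"
    and P :: "('k ^ 3) set"
    and t \<delta> :: nat
    and \<Delta>h :: "nat \<Rightarrow> int"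
  assumes "F \<in> forms 3" and "irreducible F"
    and "C = plane_curve F"
    and "singular_point F P"
    and "X \<subseteq> C" and "finite X" and "card X = 3 * t + \<delta>"
    and "P \<in> X"
    and "\<delta> \<le> 2" and "t > 3"
  defines "\<Delta>h \<equiv> hilbert_diff (double_point_ideal X)"
  shows "(\<forall>i\<le>5. \<Delta>h i = int i + 1) \<and>
    (\<forall>i\<in>{5..t + 2}. \<Delta>h i = 6) \<and>
    (\<delta> = 0 \<longrightarrow>
      \<Delta>h (t + 3) = 5 \<and> (\<forall>i\<in>{t + 4..2 * t}. \<Delta>h i = 3) \<and>
      \<Delta>h (2 * t + 1) = 1 \<and> (\<forall>i\<ge>2 * t + 2. \<Delta>h i = 0)) \<and>
    (\<delta> = 1 \<longrightarrow>
      (\<Delta>h (t + 3) = 6 \<and> (\<forall>i\<in>{t + 4..2 * t + 1}. \<Delta>h i = 3) \<and>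
       (\<forall>i\<ge>2 * t + 2. \<Delta>h i = 0)) \<or>
      (\<Delta>h (t + 3) = 5 \<and> \<Delta>h (t + 4) = 4 \<and>
       (\<forall>i\<in>{t + 5..2 * t + 1}. \<Delta>h i = 3) \<and> (\<forall>i\<ge>2 * t + 2. \<Delta>h i = 0))) \<and>
    (\<delta> = 2 \<longrightarrow>
      \<Delta>h (t + 3) = 6 \<and> \<Delta>h (t + 4) = 4 \<and>
      (\<forall>i\<in>{t + 5..2 * t + 1}. \<Delta>h i = 3) \<and>
      \<Delta>h (2 * t + 2) = 2 \<and> (\<forall>i\<ge>2 * t + 3. \<Delta>h i = 0))"
proof -
  have "P \<in> plane_curve F" using \<open>singular_point F P\<close> by (simp add: singular_point_def)
  then obtain w where w: "P = vec.span {w}" "w \<noteq> 0" by (auto simp: plane_curve_def proj_plane_def)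
  have wP: "w \<in> P" unfolding w(1) by (rule vec.span_base) simp
  have Fw: "eval F w = 0" "eval (partial_deriv i F) w = 0" for i
    using \<open>singular_point F P\<close> wP by (auto simp: singular_point_def plane_curve_def vanishes_at_def)
  have "\<exists>a. p = vec.span {a} \<and> a \<noteq> 0 \<and> eval F a = 0" if p: "p \<in> X" for p
  proof -
    have "p \<in> plane_curve F" using p \<open>X \<subseteq> C\<close> \<open>C = plane_curve F\<close> by blast
    then obtain a where a: "p = vec.span {a}" "a \<noteq> 0" "vanishes_at F p"
      by (auto simp: plane_curve_def proj_plane_def)
    then show ?thesis using vanishes_at_span[OF \<open>F \<in> forms 3\<close>, of a] by blast
  qed
  then obtain rep where rep: "p = vec.span {rep p}" "rep p \<noteq> 0" "eval F (rep p) = 0" if "p \<in> X" for p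
    by metis
  have "rep p \<notin> vec.span {w}" if p: "p \<in> X - {P}" for p
    using span_singleton_eqI[of "rep p" w] rep[of p] p w(1) by auto
  then have A: "a \<notin> vec.span {w}" if "a \<in> rep ` (X - {P})" for a using that by blast
  have finA: "finite (rep ` (X - {P}))" using \<open>finite X\<close> by simp
  obtain u v xs ys zs q k where chart: "nodal_cuspidal_cubic u v w xs ys zs F q k"
      and ys: "\<forall>a\<in>rep ` (X - {P}). dot ys a \<noteq> 0"
    using singular_cubic_chart[OF \<open>F \<in> forms 3\<close> \<open>irreducible F\<close> Fw w(2) finA A] .
  interpret nodal_cuspidal_cubic u v w xs ys zs F q k by (rule chart)
  \<comment> \<open>The parameters of the points of \<open>X\<close> other than \<open>P\<close>. A
    root of \<open>q\<close> is a parameter of the singular point and has no meaningful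
    \<open>pt\<close>.\<close>
  define S where "S = {s. poly q s \<noteq> 0 \<and> vec.span {pt s} \<in> X - {P}}"
  have S_image: "(\<lambda>s. vec.span {pt s}) ` S = X - {P}"
  proof
    show "X - {P} \<subseteq> (\<lambda>s. vec.span {pt s}) ` S"
    proof
      fix p assume p: "p \<in> X - {P}"
      define b where "b = dot ys (rep p)"
      have b: "b \<noteq> 0" using ys p by (simp add: b_def)
      \<comment> \<open>Rescaling to \<open>Y = 1\<close> is possible because the chart was chosen
        with \<open>Y\<close> nonzero on all these points; then the affine equation identifies the
        point as \<open>pt\<close> of its \<open>X\<close> coordinate.\<close>
      define a where "a = inverse b *s rep p"
      have "dot ys a = 1" using b by (simp add: a_def dot_linear b_def)
      then have "a = dot xs a *s u + v + dot zs a *s w" using vec_decomp[of a] by simp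
      moreover have "eval F a = 0"
        using rep(3)[of p] p eval_scale[OF \<open>F \<in> forms 3\<close>, of "inverse b" "rep p"] by (simp add: a_def)
      ultimately have pt: "poly q (dot xs a) \<noteq> 0" "a = pt (dot xs a)"
        by (rule point_on_curve_eq_pt)+
      have "a \<noteq> 0" using \<open>dot ys a = 1\<close> by (auto simp: dot_def)
      moreover have "a \<in> vec.span {rep p}" unfolding a_def by (intro vec.span_scale vec.span_base) simp
      ultimately have "vec.span {a} = vec.span {rep p}" by (intro span_singleton_eqI)
      then have "vec.span {pt (dot xs a)} = p" using pt(2) rep(1)[of p] p by simp
      then show "p \<in> (\<lambda>s. vec.span {pt s}) ` S" using pt(1) p by (auto simp: S_def)
    qed
  qed (auto simp: S_def)
  have "finite S"
  proof (rule finite_imageD)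
    show "finite ((\<lambda>s. vec.span {pt s}) ` S)" unfolding S_image using \<open>finite X\<close> by simp
  qed (rule inj_on_subset[OF inj_pt_span subset_UNIV])
  then interpret cubic_points u v w xs ys zs F q k S
    by unfold_locales (simp_all add: S_def)
  have X: "double_scheme = X" unfolding double_scheme_def S_image using w(1) \<open>P \<in> X\<close> by blast
  have n: "card S + 1 = 3 * t + \<delta>" using card_double_scheme(2) X \<open>card X = 3 * t + \<delta>\<close> by simp
  define h where "h = hilbert_function (double_point_ideal X)"
  have N: "2 * form_space.dim (forms d :: 'k form_ring set) = (d + 1) * (d + 2)" for d
    by (rule form_space_basis(3))
  note arith = hilbert_function_arith[where N = "\<lambda>d. form_space.dim (forms d :: 'k form_ring set)"
      and n = "card S" and h = h and a = "\<lambda>e. form_space.dim (forms_through_S e)"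
      and b = "\<lambda>d. form_space.dim (double_point_ideal X \<inter> forms d)",
      OF N dim_forms_le_forms_through_S dim_forms_through_S_lower dim_forms_through_S_upper
        dim_forms_le_double_point_ideal[OF card_double_scheme(1) double_scheme_in_plane, unfolded card_double_scheme(2), unfolded X]
        dim_double_ideal_lower[unfolded X] dim_double_ideal_upper[unfolded X]
        hilbert_function_double_scheme[unfolded X, folded h_def]]
  have "card S > 6" using n \<open>t > 3\<close> by simp
  note arith = arith[OF this]
  have "\<Delta>h i = int (h i) - (if i = 0 then 0 else int (h (i - 1)))" for i
    unfolding \<Delta>h_def hilbert_diff_def h_def ..
  with N arith n \<open>\<delta> \<le> 2\<close> \<open>t > 3\<close> show ?thesis by (rule hilbert_diff_arith)
qed

end
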